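(* The λ-theory $\mathcal{H}^+$ satisfies the ω-rule: for all $M,N\in\Lambda$, if $\mathcal{H}^+\vdash MP=NP$ for every closed λ-term $P$, then $\mathcal{H}^+\vdash M=N$. Consequently $\mathcal{B}\omega\subseteq\mathcal{H}^+$.
   Context: $\Lambda$ is the set of untyped λ-terms (up to α-conversion). A λ-theory is a congruence on $\Lambda$ containing β-conversion. The Böhm tree $BT(M)$ is the coinductively defined labelled tree: if $M$ head-reduces to $\lambda x_1\dots x_n.yM_1\cdots M_k$ then $BT(M)$ has root labelled $\lambda x_1\dots x_n.y$ with children $BT(M_1),\dots,BT(M_k)$; otherwise $BT(M)=\bot$. $\mathcal{B}=\{(M,N):BT(M)=BT(N)\}$. The ω-rule: if $MP=NP$ for all closed $P$ then $M=N$; $\mathcal{B}\omega$ is the least λ-theory containing $\mathcal{B}$ closed under the ω-rule. $M=_{\mathcal{H}^+}N$ iff for every context $C[\,]$, $C[M]$ has a β-normal form iff $C[N]$ has one. *)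

theory Defs
  imports Main
begin

datatype lterm = Var nat | App lterm lterm | Abs lterm

primrec lift :: "lterm \<Rightarrow> nat \<Rightarrow> lterm" where
  "lift (Var i) k = (if i < k then Var i else Var (i + 1))"
| "lift (App s t) k = App (lift s k) (lift t k)"
| "lift (Abs s) k = Abs (lift s (k + 1))"

primrec subst :: "lterm \<Rightarrow> lterm \<Rightarrow> nat \<Rightarrow> lterm" where
  "subst (Var i) s k = (if k < i then Var (i - 1) else if i = k then s else Var i)"
| "subst (App t u) s k = App (subst t s k) (subst u s k)"
| "subst (Abs t) s k = Abs (subst t (lift s 0) (k + 1))"

primrec closed_at :: "nat \<Rightarrow> lterm \<Rightarrow> bool" where
  "closed_at k (Var i) = (i < k)"
| "closed_at k (App s t) = (closed_at k s \<and> closed_at k t)"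
| "closed_at k (Abs s) = closed_at (Suc k) s"

definition closed :: "lterm \<Rightarrow> bool" where
  "closed M = closed_at 0 M"

inductive beta :: "lterm \<Rightarrow> lterm \<Rightarrow> bool" where
  beta_red: "beta (App (Abs s) t) (subst s t 0)"
| appL: "beta s s' \<Longrightarrow> beta (App s t) (App s' t)"
| appR: "beta t t' \<Longrightarrow> beta (App s t) (App s t')"
| abs: "beta s s' \<Longrightarrow> beta (Abs s) (Abs s')"

definition beta_nf :: "lterm \<Rightarrow> bool" where
  "beta_nf M = (\<nexists>N. beta M N)"

definition has_nf :: "lterm \<Rightarrow> bool" where
  "has_nf M = (\<exists>N. beta\<^sup>*\<^sup>* M N \<and> beta_nf N)"

definition beta_conv :: "lterm \<Rightarrow> lterm \<Rightarrow> bool" where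
  "beta_conv = (sup beta beta\<inverse>\<inverse>)\<^sup>*\<^sup>*"

inductive hred :: "lterm \<Rightarrow> lterm \<Rightarrow> bool" where
  hred_beta: "hred (App (Abs s) t) (subst s t 0)"
| hred_abs: "hred s s' \<Longrightarrow> hred (Abs s) (Abs s')"
| hred_app: "hred s s' \<Longrightarrow> (\<forall>u. s \<noteq> Abs u) \<Longrightarrow> hred (App s t) (App s' t)"

definition absn :: "nat \<Rightarrow> lterm \<Rightarrow> lterm" where
  "absn n M = (Abs ^^ n) M"

definition apps :: "lterm \<Rightarrow> lterm list \<Rightarrow> lterm" where
  "apps h Ms = foldl App h Ms"

definition head_reduces_to :: "lterm \<Rightarrow> nat \<Rightarrow> nat \<Rightarrow> lterm list \<Rightarrow> bool" where
  "head_reduces_to M n y Ms = hred\<^sup>*\<^sup>* M (absn n (apps (Var y) Ms))"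

definition has_hnf :: "lterm \<Rightarrow> bool" where
  "has_hnf M = (\<exists>n y Ms. head_reduces_to M n y Ms)"

text \<open>Equality of Boehm trees, as the greatest bisimulation on the coinductively
  defined labelled trees (label = (number of abstractions, head variable index)).\<close>
coinductive bt_eq :: "lterm \<Rightarrow> lterm \<Rightarrow> bool" where
  bt_bot: "\<not> has_hnf M \<Longrightarrow> \<not> has_hnf N \<Longrightarrow> bt_eq M N"
| bt_node: "head_reduces_to M n y Ms \<Longrightarrow> head_reduces_to N n y Ns \<Longrightarrow>
            list_all2 bt_eq Ms Ns \<Longrightarrow> bt_eq M N"
  monos list.rel_mono

inductive bomega :: "lterm \<Rightarrow> lterm \<Rightarrow> bool" where
  bo_B: "bt_eq M N \<Longrightarrow> bomega M N"
| bo_beta: "beta_conv M N \<Longrightarrow> bomega M N"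
| bo_refl: "bomega M M"
| bo_sym: "bomega M N \<Longrightarrow> bomega N M"
| bo_trans: "bomega M N \<Longrightarrow> bomega N L \<Longrightarrow> bomega M L"
| bo_app: "bomega M M' \<Longrightarrow> bomega N N' \<Longrightarrow> bomega (App M N) (App M' N')"
| bo_abs: "bomega M N \<Longrightarrow> bomega (Abs M) (Abs N)"
| bo_omega: "(\<And>P. closed P \<Longrightarrow> bomega (App M P) (App N P)) \<Longrightarrow> bomega M N"

text \<open>Contexts: terms with (possibly several) holes; filling a hole may capture variables.\<close>
datatype ctx = Hole | CVar nat | CApp ctx ctx | CAbs ctx

primrec plug :: "ctx \<Rightarrow> lterm \<Rightarrow> lterm" where
  "plug Hole M = M"
| "plug (CVar i) M = Var i"
| "plug (CApp C D) M = App (plug C M) (plug D M)"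
| "plug (CAbs C) M = Abs (plug C M)"

definition hplus :: "lterm \<Rightarrow> lterm \<Rightarrow> bool" where
  "hplus M N = (\<forall>C. has_nf (plug C M) \<longleftrightarrow> has_nf (plug C N))"

end

(* Having a normal form is the same as termination of leftmost reduction, an inductive predicate nm
   along which everything is proved.

   The omega rule.  For closed M and N a context lemma reduces H+ equality to agreement of nm on all
   M P1 ... Pk and N P1 ... Pk, where the Pi may be open and k may be assumed large.  Let A and B be
   two such applications and nm A.  The hypothesis yields A s = B s in H+ for all closed substitutions
   s; use only those replacing every variable v by a tuple \<lambda>y1 ... yp z. z y1 ... yp whose width p
   exceeds a bound P v.  Equal applications of tuples of independently chosen widths have the same
   head variable and arity, and selectors extract their arguments, at the price of raising P v.  By
   induction on nm A the tree of B is therefore a finite tree with eta expansions of variables at the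
   leaves.  Such an expansion is finite: for suitable tuples s the term B s is normalising, and inside
   an expansion of y only the bound at y and at later bound variables is raised, so the substitution
   that keeps these variables free and agrees with s elsewhere remains admissible, and the
   normalisation of its instance of B bounds the depth of the expansion.

   Equality of Boehm trees is contained in H+ because its closure under contexts and substitution
   preserves nm. *)

theory Submission
  imports Defs
begin

section \<open>Simultaneous substitution\<close>

text \<open>Parallel renamings and substitutions obey composition laws free of index arithmetic;
  \<open>lift\<close> and \<open>subst\<close> are rewritten into them once and for all.\<close>

primrec ren :: "(nat \<Rightarrow> nat) \<Rightarrow> lterm \<Rightarrow> lterm" where
  "ren r (Var i) = Var (r i)"
| "ren r (App s t) = App (ren r s) (ren r t)"
| "ren r (Abs s) = Abs (ren (case_nat 0 (\<lambda>i. Suc (r i))) s)"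

definition up :: "(nat \<Rightarrow> lterm) \<Rightarrow> nat \<Rightarrow> lterm" where
  "up \<sigma> = case_nat (Var 0) (\<lambda>i. ren Suc (\<sigma> i))"

primrec msubst :: "(nat \<Rightarrow> lterm) \<Rightarrow> lterm \<Rightarrow> lterm" where
  "msubst \<sigma> (Var i) = \<sigma> i"
| "msubst \<sigma> (App s t) = App (msubst \<sigma> s) (msubst \<sigma> t)"
| "msubst \<sigma> (Abs s) = Abs (msubst (up \<sigma>) s)"

lemma up_simps [simp]: "up \<sigma> 0 = Var 0" "up \<sigma> (Suc i) = ren Suc (\<sigma> i)"
  by (simp_all add: up_def)

lemma ren_ren: "ren r (ren q M) = ren (\<lambda>i. r (q i)) M"
proof (induction M arbitrary: r q)
  case (Abs M)
  have "(\<lambda>i. case_nat 0 (\<lambda>i. Suc (r i)) (case_nat 0 (\<lambda>i. Suc (q i)) i))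
      = case_nat 0 (\<lambda>i. Suc (r (q i)))"
    by (auto split: nat.split)
  with Abs show ?case by simp
qed simp_all

lemma msubst_ren: "msubst \<sigma> (ren r M) = msubst (\<lambda>i. \<sigma> (r i)) M"
proof (induction M arbitrary: \<sigma> r)
  case (Abs M)
  have "(\<lambda>i. up \<sigma> (case_nat 0 (\<lambda>i. Suc (r i)) i)) = up (\<lambda>i. \<sigma> (r i))"
    by (auto simp: up_def split: nat.split)
  with Abs show ?case by simp
qed simp_all

lemma ren_msubst: "ren r (msubst \<sigma> M) = msubst (\<lambda>i. ren r (\<sigma> i)) M"
proof (induction M arbitrary: \<sigma> r)
  case (Abs M)
  have "(\<lambda>i. ren (case_nat 0 (\<lambda>i. Suc (r i))) (up \<sigma> i)) = up (\<lambda>i. ren r (\<sigma> i))"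
    by (auto simp: up_def ren_ren split: nat.split)
  with Abs show ?case by simp
qed simp_all

text \<open>Below a binder \<open>up\<close> inserts a renaming, so the two mixed laws
  \<open>msubst_ren\<close> and \<open>ren_msubst\<close> are what the induction consumes.\<close>

lemma msubst_msubst: "msubst \<tau> (msubst \<sigma> M) = msubst (\<lambda>i. msubst \<tau> (\<sigma> i)) M"
proof (induction M arbitrary: \<sigma> \<tau>)
  case (Abs M)
  have "(\<lambda>i. msubst (up \<tau>) (up \<sigma> i)) = up (\<lambda>i. msubst \<tau> (\<sigma> i))"
    by (auto simp: up_def msubst_ren ren_msubst split: nat.split)
  with Abs show ?case by simp
qed simp_all

lemma up_Var [simp]: "up Var = Var"
  by (auto simp: up_def split: nat.split)

lemma msubst_Var [simp]: "msubst Var M = M"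
  by (induction M) simp_all

lemma ren_conv_msubst: "ren r M = msubst (\<lambda>i. Var (r i)) M"
  using ren_msubst[of r Var M] by simp

lemma lift_conv_ren: "lift M k = ren (\<lambda>i. if i < k then i else Suc i) M"
proof (induction M arbitrary: k)
  case (Abs M)
  have "case_nat 0 (\<lambda>i. Suc (if i < k then i else Suc i)) = (\<lambda>i. if i < Suc k then i else Suc i)"
    by (auto split: nat.split)
  with Abs show ?case by simp
qed simp_all

lemma lift_0_conv_ren: "lift M 0 = ren Suc M"
  by (simp add: lift_conv_ren)

lemma subst_conv_msubst_at:
  "subst M N k = msubst (\<lambda>i. if k < i then Var (i - 1) else if i = k then N else Var i) M"
proof (induction M arbitrary: N k)
  case (Abs M)
  have "up (\<lambda>i. if k < i then Var (i - 1) else if i = k then N else Var i) =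
    (\<lambda>i. if Suc k < i then Var (i - 1) else if i = Suc k then lift N 0 else Var i)"
    by (auto simp: up_def lift_0_conv_ren split: nat.split)
  with Abs show ?case by simp
qed simp_all

lemma subst_conv_msubst: "subst M N 0 = msubst (case_nat N Var) M"
proof -
  have "(\<lambda>i. if 0 < i then Var (i - 1) else if i = 0 then N else Var i) = case_nat N Var"
    by (auto split: nat.split)
  then show ?thesis by (simp add: subst_conv_msubst_at)
qed

text \<open>Contracting a redex whose body carries a pending substitution merely extends that
  substitution, as in an environment machine. Later inductions on instances rely on this view of
  beta.\<close>

lemma subst_msubst_up: "subst (msubst (up \<sigma>) M) N 0 = msubst (case_nat N \<sigma>) M"
proof -
  have "(\<lambda>i. msubst (case_nat N Var) (up \<sigma> i)) = case_nat N \<sigma>"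
    by (auto simp: up_def msubst_ren split: nat.split)
  then show ?thesis by (simp add: subst_conv_msubst msubst_msubst)
qed

lemma msubst_subst: "msubst \<sigma> (subst M N 0) = subst (msubst (up \<sigma>) M) (msubst \<sigma> N) 0"
proof -
  have "(\<lambda>i. msubst \<sigma> (case_nat N Var i)) = case_nat (msubst \<sigma> N) \<sigma>"
    by (auto split: nat.split)
  then show ?thesis by (simp add: subst_conv_msubst[of M] subst_msubst_up msubst_msubst)
qed

lemma msubst_cong_closed_at:
  "closed_at k M \<Longrightarrow> (\<And>i. i < k \<Longrightarrow> \<sigma> i = \<tau> i) \<Longrightarrow> msubst \<sigma> M = msubst \<tau> M"
proof (induction M arbitrary: k \<sigma> \<tau>)
  case (App M N)
  show ?case
    using App.IH(1)[of k \<sigma> \<tau>] App.IH(2)[of k \<sigma> \<tau>] App.prems by simp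
next
  case (Abs M)
  have "msubst (up \<sigma>) M = msubst (up \<tau>) M"
  proof (rule Abs.IH)
    show "closed_at (Suc k) M" using Abs.prems by simp
    show "up \<sigma> i = up \<tau> i" if "i < Suc k" for i
      using that Abs.prems by (cases i) auto
  qed
  then show ?case by simp
qed simp

lemma msubst_closed: "closed M \<Longrightarrow> msubst \<sigma> M = M"
  using msubst_cong_closed_at[of 0 M \<sigma> Var] by (simp add: closed_def)

lemma ren_closed: "closed M \<Longrightarrow> ren r M = M"
  by (simp add: ren_conv_msubst msubst_closed)

lemma closed_at_mono: "closed_at k M \<Longrightarrow> k \<le> n \<Longrightarrow> closed_at n M"
  by (induction M arbitrary: k n) auto

lemma ex_closed_at: "\<exists>n. closed_at n M"
proof (induction M)
  case (App M N)
  then obtain m n where "closed_at m M" "closed_at n N" by blast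
  then have "closed_at (max m n) (App M N)"
    using closed_at_mono[of m M "max m n"] closed_at_mono[of n N "max m n"] by simp
  then show ?case ..
next
  case (Abs M)
  then obtain n where "closed_at n M" ..
  then have "closed_at n (Abs M)" using closed_at_mono[of n M "Suc n"] by simp
  then show ?case ..
qed auto

section \<open>Iterated application and abstraction\<close>

lemma apps_Nil [simp]: "apps h [] = h"
  and apps_Cons [simp]: "apps h (t # ts) = apps (App h t) ts"
  and apps_snoc: "apps h (ts @ [t]) = App (apps h ts) t"
  and apps_append: "apps h (ts @ us) = apps (apps h ts) us"
  by (simp_all add: apps_def)

lemma absn_0 [simp]: "absn 0 M = M" and absn_Suc [simp]: "absn (Suc n) M = Abs (absn n M)"
  by (simp_all add: absn_def)

lemma absn_Suc_right: "absn (Suc n) M = absn n (Abs M)"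
  by (simp add: absn_def funpow_swap1)

lemma msubst_apps: "msubst \<sigma> (apps h ts) = apps (msubst \<sigma> h) (map (msubst \<sigma>) ts)"
  by (induction ts arbitrary: h) simp_all

lemma ren_apps: "ren r (apps h ts) = apps (ren r h) (map (ren r) ts)"
  by (induction ts arbitrary: h) simp_all

lemma closed_at_apps: "closed_at k (apps h ts) \<longleftrightarrow> closed_at k h \<and> (\<forall>t\<in>set ts. closed_at k t)"
  by (induction ts arbitrary: h) auto

lemma closed_at_absn: "closed_at k (absn n M) \<longleftrightarrow> closed_at (k + n) M"
  by (induction n arbitrary: k) auto

section \<open>Weak head reduction and leftmost normalisation\<close>

text \<open>Head reduction that never enters an abstraction. The application rule has no side
  condition, in contrast to \<open>hred\<close>, so a step survives both substitution and the
  addition of arguments.\<close>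

inductive wh :: "lterm \<Rightarrow> lterm \<Rightarrow> bool" where
  wh_beta: "wh (App (Abs s) t) (subst s t 0)"
| wh_app: "wh s s' \<Longrightarrow> wh (App s t) (App s' t)"

inductive_cases wh_VarE [elim!]: "wh (Var i) M"
inductive_cases wh_AbsE [elim!]: "wh (Abs s) M"
inductive_cases wh_AppE [elim!]: "wh (App s t) M"

lemma wh_det: "wh M N \<Longrightarrow> wh M N' \<Longrightarrow> N = N'"
proof (induction arbitrary: N' rule: wh.induct)
  case (wh_beta s t)
  from wh_beta.prems show ?case by (rule wh_AppE) (simp, erule wh_AbsE)
next
  case (wh_app s s' t)
  from wh_app.prems show ?case
  proof (rule wh_AppE)
    fix u assume "s = Abs u"
    with wh_app.hyps show ?thesis by (metis wh_AbsE)
  next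
    fix s'' assume "N' = App s'' t" "wh s s''"
    with wh_app.IH[of s''] show ?thesis by simp
  qed
qed

lemma apps_Var_neq_Abs [simp]: "apps (Var y) Ms \<noteq> Abs M" "Abs M \<noteq> apps (Var y) Ms"
  by (induction Ms rule: rev_induct) (auto simp: apps_snoc)

lemma wh_neutral [simp]: "\<not> wh (apps (Var y) Ms) M"
  by (induction Ms arbitrary: M rule: rev_induct) (auto simp: apps_snoc)

lemma apps_Var_inject [simp]: "apps (Var x) Xs = apps (Var y) Ys \<longleftrightarrow> x = y \<and> Xs = Ys"
proof (induction Xs arbitrary: Ys rule: rev_induct)
  case Nil
  show ?case by (cases Ys rule: rev_cases) (auto simp: apps_snoc)
next
  case (snoc a Xs)
  then show ?case by (cases Ys rule: rev_cases) (auto simp: apps_snoc)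
qed

lemma wh_cases:
  obtains (Abs) M1 where "M = Abs M1" | (neutral) y Ms where "M = apps (Var y) Ms"
  | (step) M' where "wh M M'"
proof -
  have "(\<exists>M1. M = Abs M1) \<or> (\<exists>y Ms. M = apps (Var y) Ms) \<or> (\<exists>M'. wh M M')"
  proof (induction M)
    case (Var x)
    have "Var x = apps (Var x) []" by simp
    then show ?case by blast
  next
    case (App M N)
    have "\<exists>zs. App (apps (Var y) Ms) N = apps (Var y) zs" for y Ms
      by (rule exI[of _ "Ms @ [N]"]) (simp add: apps_snoc)
    with App.IH(1) show ?case by (blast intro: wh.intros)
  qed blast
  then show thesis using that by blast
qed

lemma wh_msubst: "wh M N \<Longrightarrow> wh (msubst \<sigma> M) (msubst \<sigma> N)"
  by (induction rule: wh.induct) (auto simp: msubst_subst intro: wh.intros)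

lemma wh_ren: "wh M N \<Longrightarrow> wh (ren r M) (ren r N)"
  by (simp add: ren_conv_msubst wh_msubst)

lemma wh_apps: "wh M N \<Longrightarrow> wh (apps M Ps) (apps N Ps)"
  by (induction Ps arbitrary: M N) (auto intro: wh.intros)

lemma whs_msubst: "wh\<^sup>*\<^sup>* M N \<Longrightarrow> wh\<^sup>*\<^sup>* (msubst \<sigma> M) (msubst \<sigma> N)"
  by (induction rule: rtranclp_induct) (auto intro: wh_msubst rtranclp.rtrancl_into_rtrancl)

lemma whs_apps: "wh\<^sup>*\<^sup>* M N \<Longrightarrow> wh\<^sup>*\<^sup>* (apps M Ps) (apps N Ps)"
  by (induction rule: rtranclp_induct) (auto intro: wh_apps rtranclp.rtrancl_into_rtrancl)

lemma whs_App: "wh\<^sup>*\<^sup>* M N \<Longrightarrow> wh\<^sup>*\<^sup>* (App M P) (App N P)"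
  using whs_apps[of M N "[P]"] by simp

text \<open>Leftmost normalisation as a least fixed point: weak head steps explore a finite Boehm
  tree without bottom. Its rule induction is the main induction of the development.\<close>

inductive nm :: "lterm \<Rightarrow> bool" where
  nm_neutralI: "(\<And>M. M \<in> set Ms \<Longrightarrow> nm M) \<Longrightarrow> nm (apps (Var y) Ms)"
| nm_AbsI: "nm M \<Longrightarrow> nm (Abs M)"
| nm_whI: "wh M N \<Longrightarrow> nm N \<Longrightarrow> nm M"

lemma nm_Abs [simp]: "nm (Abs M) \<longleftrightarrow> nm M"
  by (auto elim: nm.cases intro: nm_AbsI)

lemma nm_neutral [simp]: "nm (apps (Var y) Ms) \<longleftrightarrow> (\<forall>M\<in>set Ms. nm M)"
proof
  assume "nm (apps (Var y) Ms)"
  then show "\<forall>M\<in>set Ms. nm M" by cases auto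
qed (auto intro: nm_neutralI)

lemma nm_Var [simp]: "nm (Var y)"
  using nm_neutral[of y "[]"] by simp

lemma nm_wh: "wh M N \<Longrightarrow> nm M \<longleftrightarrow> nm N"
proof
  assume "wh M N" "nm M"
  from this(2,1) show "nm N" by cases (auto dest: wh_det)
qed (rule nm_whI)

lemma nm_whs: "wh\<^sup>*\<^sup>* M N \<Longrightarrow> nm M \<longleftrightarrow> nm N"
  by (induction rule: rtranclp_induct) (auto simp: nm_wh)

section \<open>Standardisation\<close>

lemma wh_imp_beta: "wh M N \<Longrightarrow> beta M N"
  by (induction rule: wh.induct) (auto intro: beta.intros)

lemma betas_Abs: "beta\<^sup>*\<^sup>* M N \<Longrightarrow> beta\<^sup>*\<^sup>* (Abs M) (Abs N)"
  by (induction rule: rtranclp_induct) (auto intro: beta.intros rtranclp.rtrancl_into_rtrancl)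

lemma betas_App:
  assumes "beta\<^sup>*\<^sup>* M M'" "beta\<^sup>*\<^sup>* N N'"
  shows "beta\<^sup>*\<^sup>* (App M N) (App M' N')"
proof -
  have "beta\<^sup>*\<^sup>* (App M N) (App M' N)"
    using assms(1)
    by (induction rule: rtranclp_induct) (auto intro: beta.intros rtranclp.rtrancl_into_rtrancl)
  also have "beta\<^sup>*\<^sup>* (App M' N) (App M' N')"
    using assms(2)
    by (induction rule: rtranclp_induct) (auto intro: beta.intros rtranclp.rtrancl_into_rtrancl)
  finally show ?thesis .
qed

lemma betas_apps: "list_all2 beta\<^sup>*\<^sup>* Ms Ns \<Longrightarrow> beta\<^sup>*\<^sup>* M N \<Longrightarrow> beta\<^sup>*\<^sup>* (apps M Ms) (apps N Ns)"
  by (induction arbitrary: M N rule: list_all2_induct) (auto intro: betas_App)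

inductive_cases beta_VarE: "beta (Var i) M"
inductive_cases beta_AbsE: "beta (Abs M) N"
inductive_cases beta_AppE: "beta (App M N) P"

lemma beta_nf_Var [simp]: "beta_nf (Var i)"
  by (auto simp: beta_nf_def elim: beta_VarE)

lemma beta_nf_Abs [simp]: "beta_nf (Abs M) \<longleftrightarrow> beta_nf M"
  by (auto simp: beta_nf_def elim: beta_AbsE intro: beta.intros)

lemma beta_nf_neutral [simp]: "beta_nf (apps (Var y) Ms) \<longleftrightarrow> (\<forall>M\<in>set Ms. beta_nf M)"
proof (induction Ms rule: rev_induct)
  case (snoc M Ms)
  have "beta_nf (App (apps (Var y) Ms) M) \<longleftrightarrow> beta_nf (apps (Var y) Ms) \<and> beta_nf M"
    unfolding beta_nf_def by (auto intro: beta.intros elim!: beta_AppE)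
  with snoc show ?case by (auto simp: apps_snoc)
qed simp

lemma nm_imp_has_nf: "nm M \<Longrightarrow> has_nf M"
proof (induction rule: nm.induct)
  case (nm_neutralI Ms y)
  then have "\<forall>M\<in>set Ms. \<exists>N. beta\<^sup>*\<^sup>* M N \<and> beta_nf N" by (simp add: has_nf_def)
  then obtain f where f: "\<forall>M\<in>set Ms. beta\<^sup>*\<^sup>* M (f M) \<and> beta_nf (f M)" by metis
  then have "list_all2 beta\<^sup>*\<^sup>* Ms (map f Ms)"
    by (simp add: list.rel_map list.rel_refl_strong)
  then have "beta\<^sup>*\<^sup>* (apps (Var y) Ms) (apps (Var y) (map f Ms))" by (rule betas_apps) simp
  moreover have "beta_nf (apps (Var y) (map f Ms))" using f by auto
  ultimately show ?case unfolding has_nf_def by blast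
next
  case (nm_AbsI M)
  then obtain N where "beta\<^sup>*\<^sup>* M N" "beta_nf N" by (auto simp: has_nf_def)
  then have "beta\<^sup>*\<^sup>* (Abs M) (Abs N)" "beta_nf (Abs N)" by (simp_all add: betas_Abs)
  then show ?case unfolding has_nf_def by blast
next
  case (nm_whI M N)
  then show ?case unfolding has_nf_def by (meson converse_rtranclp_into_rtranclp wh_imp_beta)
qed

text \<open>Kashima's inductive presentation of standard reduction sequences.\<close>

inductive st :: "lterm \<Rightarrow> lterm \<Rightarrow> bool" where
  st_Var: "wh\<^sup>*\<^sup>* M (Var i) \<Longrightarrow> st M (Var i)"
| st_App: "wh\<^sup>*\<^sup>* M (App A B) \<Longrightarrow> st A C \<Longrightarrow> st B D \<Longrightarrow> st M (App C D)"
| st_Abs: "wh\<^sup>*\<^sup>* M (Abs A) \<Longrightarrow> st A B \<Longrightarrow> st M (Abs B)"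

inductive_cases st_VarE: "st M (Var i)"
inductive_cases st_AppE: "st M (App C D)"
inductive_cases st_AbsE: "st M (Abs B)"

lemma st_refl: "st M M"
  by (induction M) (auto intro: st.intros)

lemma whs_st: "wh\<^sup>*\<^sup>* M N \<Longrightarrow> st N P \<Longrightarrow> st M P"
  by (erule st.cases) (metis rtranclp_trans st.intros)+

lemma st_ren: "st M N \<Longrightarrow> st (ren r M) (ren r N)"
proof (induction arbitrary: r rule: st.induct)
  case (st_Var M i)
  from whs_msubst[OF st_Var, of "\<lambda>i. Var (r i)"] show ?case
    by (auto simp: ren_conv_msubst intro: st.intros)
next
  case (st_App M A B C D)
  from whs_msubst[OF st_App(1), of "\<lambda>i. Var (r i)"] st_App(4,5) show ?case
    by (auto simp: ren_conv_msubst intro!: st.intros)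
next
  case (st_Abs M A B)
  from whs_msubst[OF st_Abs(1), of "\<lambda>i. Var (r i)"]
  have "wh\<^sup>*\<^sup>* (ren r M) (ren r (Abs A))" by (simp only: ren_conv_msubst)
  with st_Abs(3) show ?case by (auto intro: st.intros)
qed

lemma st_msubst: "st M N \<Longrightarrow> (\<And>i. st (\<sigma> i) (\<tau> i)) \<Longrightarrow> st (msubst \<sigma> M) (msubst \<tau> N)"
proof (induction arbitrary: \<sigma> \<tau> rule: st.induct)
  case (st_Var M i)
  from whs_msubst[OF st_Var(1), of \<sigma>] st_Var(2)[of i] show ?case by (auto intro: whs_st)
next
  case (st_App M A B C D)
  have "st (msubst \<sigma> A) (msubst \<tau> C)" "st (msubst \<sigma> B) (msubst \<tau> D)"
    using st_App.IH st_App.prems by blast+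
  with whs_msubst[OF st_App(1), of \<sigma>] show ?case by (auto intro: st.intros)
next
  case (st_Abs M A B)
  have "st (up \<sigma> i) (up \<tau> i)" for i
    using st_Abs.prems by (cases i) (auto intro: st_refl st_ren)
  then have "st (msubst (up \<sigma>) A) (msubst (up \<tau>) B)" by (rule st_Abs.IH)
  with whs_msubst[OF st_Abs(1), of \<sigma>] show ?case by (auto intro: st.intros)
qed

text \<open>The core of standardisation: a further beta step is absorbed. For a root redex, the
  function part reaches an abstraction by weak head steps, so the redex is fired early, and
  \<open>st_msubst\<close> relates the contracta.\<close>

lemma st_beta: "beta N P \<Longrightarrow> st M N \<Longrightarrow> st M P"
proof (induction arbitrary: M rule: beta.induct)
  case (beta_red s t)
  then obtain A B where AB: "wh\<^sup>*\<^sup>* M (App A B)" "st A (Abs s)" "st B t" by (auto elim: st_AppE)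
  from AB(2) obtain A1 where A1: "wh\<^sup>*\<^sup>* A (Abs A1)" "st A1 s" by (auto elim: st_AbsE)
  have "wh\<^sup>*\<^sup>* M (App (Abs A1) B)" using AB(1) whs_App[OF A1(1)] by (rule rtranclp_trans)
  then have "wh\<^sup>*\<^sup>* M (subst A1 B 0)" using wh_beta by (rule rtranclp.rtrancl_into_rtrancl)
  moreover have "st (subst A1 B 0) (subst s t 0)"
    unfolding subst_conv_msubst using A1(2)
    by (rule st_msubst) (simp add: AB(3) st_refl split: nat.split)
  ultimately show ?case by (rule whs_st)
next
  case (appL s s' t)
  then show ?case by (auto elim!: st_AppE intro: st.intros)
next
  case (appR t t' s)
  then show ?case by (auto elim!: st_AppE intro: st.intros)
next
  case (abs s s')
  then show ?case by (auto elim!: st_AbsE intro: st.intros)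
qed

lemma betas_imp_st: "beta\<^sup>*\<^sup>* M N \<Longrightarrow> st M N"
  by (induction rule: rtranclp_induct) (auto intro: st_refl st_beta)

lemma st_neutral:
  "st M (apps (Var y) Ns) \<Longrightarrow> \<exists>Ms. wh\<^sup>*\<^sup>* M (apps (Var y) Ms) \<and> list_all2 st Ms Ns"
proof (induction Ns arbitrary: M rule: rev_induct)
  case Nil
  then have "wh\<^sup>*\<^sup>* M (apps (Var y) [])" by (auto elim: st_VarE)
  then show ?case by blast
next
  case (snoc N Ns)
  then obtain A B where AB: "wh\<^sup>*\<^sup>* M (App A B)" "st A (apps (Var y) Ns)" "st B N"
    by (auto simp: apps_snoc elim: st_AppE)
  from snoc.IH[OF AB(2)] obtain Ms where
    Ms: "wh\<^sup>*\<^sup>* A (apps (Var y) Ms)" "list_all2 st Ms Ns" by blast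
  have "wh\<^sup>*\<^sup>* M (apps (Var y) (Ms @ [B]))"
    unfolding apps_snoc using AB(1) whs_App[OF Ms(1)] by (rule rtranclp_trans)
  moreover have "list_all2 st (Ms @ [B]) (Ns @ [N])"
    using Ms(2) AB(3) by (simp add: list_all2_appendI)
  ultimately show ?case by blast
qed

lemma size_in_apps: "M \<in> set Ms \<Longrightarrow> size M < size (apps h Ms)"
proof (induction Ms rule: rev_induct)
  case (snoc N Ms)
  then show ?case by (auto simp: apps_snoc)
qed simp

text \<open>A standard sequence starts with weak head steps that expose the top structure of its
  target, which matches the rules of \<open>nm\<close>. The induction is on size because the
  arguments of a neutral term need not be immediate subterms.\<close>

lemma st_nf_imp_nm: "st M N \<Longrightarrow> beta_nf N \<Longrightarrow> nm M"
proof (induction N arbitrary: M rule: measure_induct_rule[of size])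
  case (less N)
  show ?case
  proof (cases N rule: wh_cases)
    case (Abs N1)
    with less.prems(1) obtain M1 where "wh\<^sup>*\<^sup>* M (Abs M1)" "st M1 N1" by (auto elim: st_AbsE)
    moreover have "nm M1" using \<open>st M1 N1\<close> less Abs by auto
    ultimately show ?thesis by (simp add: nm_whs)
  next
    case (neutral y Ns)
    with less.prems(1) obtain Ms where Ms: "wh\<^sup>*\<^sup>* M (apps (Var y) Ms)" "list_all2 st Ms Ns"
      using st_neutral by blast
    have "nm P" if "P \<in> set Ms" for P
    proof -
      from that Ms(2) obtain Q where "Q \<in> set Ns" "st P Q"
        by (metis in_set_conv_nth list_all2_conv_all_nth)
      then show ?thesis using less.IH[of Q P] less.prems(2) neutral size_in_apps[of Q Ns] by simp
    qed
    with Ms(1) show ?thesis by (simp add: nm_whs)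
  next
    case (step N')
    with less.prems(2) show ?thesis by (auto simp: beta_nf_def dest: wh_imp_beta)
  qed
qed

theorem has_nf_iff_nm: "has_nf M \<longleftrightarrow> nm M"
  using nm_imp_has_nf by (auto simp: has_nf_def dest: betas_imp_st st_nf_imp_nm)

section \<open>Invariance of normalisation under conversion\<close>

text \<open>A weak head contraction may copy or erase a beta redex lying elsewhere. A parallel step
  remains one parallel step under this, and so can be pushed through a derivation of
  \<open>nm\<close>.\<close>

inductive par :: "lterm \<Rightarrow> lterm \<Rightarrow> bool" where
  par_Var: "par (Var i) (Var i)"
| par_App: "par s s' \<Longrightarrow> par t t' \<Longrightarrow> par (App s t) (App s' t')"
| par_Abs: "par s s' \<Longrightarrow> par (Abs s) (Abs s')"
| par_beta: "par s s' \<Longrightarrow> par t t' \<Longrightarrow> par (App (Abs s) t) (subst s' t' 0)"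

inductive_cases par_VarE: "par (Var i) M"
inductive_cases par_AbsE: "par (Abs s) M"
inductive_cases par_AppE: "par (App s t) M"

lemma par_refl: "par M M"
  by (induction M) (auto intro: par.intros)

lemma beta_imp_par: "beta M N \<Longrightarrow> par M N"
  by (induction rule: beta.induct) (auto intro: par.intros par_refl)

lemma par_ren: "par M N \<Longrightarrow> par (ren r M) (ren r N)"
proof (induction arbitrary: r rule: par.induct)
  case (par_beta s s' t t')
  have up: "up (\<lambda>i. Var (r i)) = (\<lambda>i. Var (case_nat 0 (\<lambda>i. Suc (r i)) i))"
    by (auto simp: up_def split: nat.split)
  show ?case
    using par.par_beta[OF par_beta.IH(1)[of "case_nat 0 (\<lambda>i. Suc (r i))"] par_beta.IH(2)[of r]]
    by (simp add: ren_conv_msubst msubst_subst up)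
qed (auto intro: par.intros)

lemma par_msubst: "par M N \<Longrightarrow> (\<And>i. par (\<sigma> i) (\<tau> i)) \<Longrightarrow> par (msubst \<sigma> M) (msubst \<tau> N)"
proof (induction arbitrary: \<sigma> \<tau> rule: par.induct)
  case (par_Abs s s')
  have "par (up \<sigma> i) (up \<tau> i)" for i
    using par_Abs.prems by (cases i) (auto intro: par_refl par_ren)
  then show ?case using par_Abs.IH by (auto intro: par.intros)
next
  case (par_beta s s' t t')
  have "par (up \<sigma> i) (up \<tau> i)" for i
    using par_beta.prems by (cases i) (auto intro: par_refl par_ren)
  then show ?case using par_beta.IH par_beta.prems by (auto simp: msubst_subst intro: par.intros)
qed (auto intro: par.intros)

lemma par_neutral: "par (apps (Var y) Ms) N \<Longrightarrow> \<exists>Ns. N = apps (Var y) Ns \<and> list_all2 par Ms Ns"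
proof (induction Ms arbitrary: N rule: rev_induct)
  case Nil
  then have "N = apps (Var y) []" by (auto elim: par_VarE)
  then show ?case by blast
next
  case (snoc M Ms)
  from snoc.prems obtain A B where AB: "N = App A B" "par (apps (Var y) Ms) A" "par M B"
    by (auto simp: apps_snoc elim: par_AppE)
  from snoc.IH[OF AB(2)] obtain Ns where Ns: "A = apps (Var y) Ns" "list_all2 par Ms Ns" by blast
  then have "N = apps (Var y) (Ns @ [B])" "list_all2 par (Ms @ [M]) (Ns @ [B])"
    using AB by (auto simp: apps_snoc list_all2_appendI)
  then show ?case by blast
qed

text \<open>The weak head step is copied on the right, except when the parallel step has already
  contracted the head redex and nothing is left to do.\<close>

lemma par_wh: "wh M M' \<Longrightarrow> par M N \<Longrightarrow> \<exists>N'. wh\<^sup>*\<^sup>* N N' \<and> par M' N'"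
proof (induction arbitrary: N rule: wh.induct)
  case (wh_beta s t)
  have sub: "par (subst s t 0) (subst s' t' 0)" if "par s s'" "par t t'" for s' t'
    unfolding subst_conv_msubst using that(1)
    by (rule par_msubst) (simp add: that(2) par_refl split: nat.split)
  from wh_beta show ?case
  proof (rule par_AppE)
    fix s1 t' assume N: "N = App s1 t'" and "par (Abs s) s1" and t': "par t t'"
    then obtain s' where s': "s1 = Abs s'" "par s s'" by (auto elim: par_AbsE)
    have "wh N (subst s' t' 0)" unfolding N s'(1) by (rule wh.wh_beta)
    with sub[OF s'(2) t'] show ?thesis by blast
  next
    fix s1 s' t' assume "Abs s = Abs s1" "N = subst s' t' 0" "par s1 s'" "par t t'"
    with sub show ?thesis by blast
  qed
next
  case (wh_app s s' t)
  from wh_app.prems show ?case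
  proof (rule par_AppE)
    fix s1 t' assume "N = App s1 t'" "par s s1" "par t t'"
    with wh_app.IH[of s1] show ?thesis by (blast intro: whs_App par.intros)
  next
    fix s1 s' t' assume "s = Abs s1"
    with wh_app.hyps show ?thesis by auto
  qed
qed

lemma par_nm: "nm M \<Longrightarrow> par M N \<Longrightarrow> nm N"
proof (induction arbitrary: N rule: nm.induct)
  case (nm_neutralI Ms y)
  from par_neutral[OF nm_neutralI.prems] obtain Ns where
    Ns: "N = apps (Var y) Ns" "list_all2 par Ms Ns" by blast
  have "nm P" if "P \<in> set Ns" for P
    using that Ns(2) nm_neutralI.IH by (metis in_set_conv_nth list_all2_conv_all_nth)
  with Ns show ?case by simp
next
  case (nm_AbsI M)
  then show ?case by (auto elim!: par_AbsE)
next
  case (nm_whI M M')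
  with par_wh[of M M' N] show ?case using nm_whs by blast
qed

lemma nm_beta: "beta M N \<Longrightarrow> nm M \<longleftrightarrow> nm N"
proof
  \<comment> \<open>Backwards nothing has to be traced: the step is put in front of a reduction of
    \<open>N\<close> to normal form.\<close>
  assume "beta M N" "nm N"
  then show "nm M"
    unfolding has_nf_iff_nm[symmetric] has_nf_def by (meson converse_rtranclp_into_rtranclp)
qed (auto dest: beta_imp_par par_nm)

lemma nm_betas: "beta\<^sup>*\<^sup>* M N \<Longrightarrow> nm M \<longleftrightarrow> nm N"
  by (induction rule: rtranclp_induct) (auto simp: nm_beta)

section \<open>Observational equivalence\<close>

lemma hplus_nm: "hplus M N \<longleftrightarrow> (\<forall>C. nm (plug C M) \<longleftrightarrow> nm (plug C N))"
  by (simp add: hplus_def has_nf_iff_nm)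

lemma hplus_nmD: "hplus M N \<Longrightarrow> nm M \<longleftrightarrow> nm N"
  unfolding hplus_nm by (drule spec[of _ Hole]) simp

lemma hplus_refl: "hplus M M"
  and hplus_sym: "hplus M N \<Longrightarrow> hplus N M"
  and hplus_trans: "hplus M N \<Longrightarrow> hplus N P \<Longrightarrow> hplus M P"
  by (simp_all add: hplus_def)

primrec ctx_comp :: "ctx \<Rightarrow> ctx \<Rightarrow> ctx" where
  "ctx_comp Hole D = D"
| "ctx_comp (CVar i) D = CVar i"
| "ctx_comp (CApp B C) D = CApp (ctx_comp B D) (ctx_comp C D)"
| "ctx_comp (CAbs C) D = CAbs (ctx_comp C D)"

lemma plug_ctx_comp: "plug (ctx_comp C D) M = plug C (plug D M)"
  by (induction C) simp_all

text \<open>Hole-free contexts hold one side of an application fixed while the other side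
  varies.\<close>

primrec ctx_of :: "lterm \<Rightarrow> ctx" where
  "ctx_of (Var i) = CVar i"
| "ctx_of (App M N) = CApp (ctx_of M) (ctx_of N)"
| "ctx_of (Abs M) = CAbs (ctx_of M)"

lemma plug_ctx_of [simp]: "plug (ctx_of N) M = N"
  by (induction N) simp_all

lemma hplus_plug: "hplus M N \<Longrightarrow> hplus (plug C M) (plug C N)"
  unfolding hplus_def by (simp flip: plug_ctx_comp)

lemma hplus_Abs: "hplus M N \<Longrightarrow> hplus (Abs M) (Abs N)"
  using hplus_plug[of M N "CAbs Hole"] by simp

lemma hplus_App:
  assumes "hplus M M'" "hplus N N'"
  shows "hplus (App M N) (App M' N')"
proof -
  have "hplus (App M N) (App M' N)"
    using hplus_plug[OF assms(1), of "CApp Hole (ctx_of N)"] by simp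
  moreover have "hplus (App M' N) (App M' N')"
    using hplus_plug[OF assms(2), of "CApp (ctx_of M') Hole"] by simp
  ultimately show ?thesis by (rule hplus_trans)
qed

lemma hplus_apps: "hplus M N \<Longrightarrow> hplus (apps M Ps) (apps N Ps)"
  by (induction Ps arbitrary: M N) (auto intro: hplus_App hplus_refl)

lemma hplus_absn: "hplus M N \<Longrightarrow> hplus (absn n M) (absn n N)"
  by (induction n) (auto intro: hplus_Abs)

lemma betas_plug: "beta\<^sup>*\<^sup>* M N \<Longrightarrow> beta\<^sup>*\<^sup>* (plug C M) (plug C N)"
  by (induction C) (auto intro: betas_App betas_Abs)

lemma hplus_betas: "beta\<^sup>*\<^sup>* M N \<Longrightarrow> hplus M N"
  unfolding hplus_nm by (auto dest: betas_plug nm_betas)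

lemma hplus_beta_conv: "beta_conv M N \<Longrightarrow> hplus M N"
  unfolding beta_conv_def
proof (induction rule: rtranclp_induct)
  case (step N P)
  then have "hplus N P" by (auto intro: hplus_sym hplus_betas)
  with step show ?case by (blast intro: hplus_trans)
qed (rule hplus_refl)

section \<open>Head normal forms\<close>

lemma wh_imp_hred: "wh M N \<Longrightarrow> hred M N"
proof (induction rule: wh.induct)
  case (wh_app s s' t)
  then have "\<forall>u. s \<noteq> Abs u" by auto
  with wh_app show ?case by (simp add: hred_app)
qed (rule hred_beta)

text \<open>A head step is either weak or happens below a leading abstraction. Hence a sequence of
  \<open>hred\<close> steps splits into weak head phases, one below each leading
  abstraction.\<close>

lemma hred_imp_wh: "hred M N \<Longrightarrow> wh M N \<or> (\<exists>A B. M = Abs A \<and> N = Abs B \<and> hred A B)"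
  by (induction rule: hred.induct) (auto intro: wh.intros)

lemma whs_Abs: "wh\<^sup>*\<^sup>* (Abs A) N \<Longrightarrow> N = Abs A"
  by (erule converse_rtranclpE) auto

lemma whs_neutral: "wh\<^sup>*\<^sup>* (apps (Var y) Ms) N \<Longrightarrow> N = apps (Var y) Ms"
  by (erule converse_rtranclpE) auto

lemma head_reduces_to_0D: "head_reduces_to M 0 y Ms \<Longrightarrow> wh\<^sup>*\<^sup>* M (apps (Var y) Ms)"
  unfolding head_reduces_to_def absn_0
proof (induction rule: converse_rtranclp_induct)
  case (step M M')
  from hred_imp_wh[OF step.hyps(1)] step.IH show ?case
    by (auto dest: whs_Abs intro: converse_rtranclp_into_rtranclp)
qed simp

lemma head_reduces_to_SucD:
  assumes "head_reduces_to M (Suc n) y Ms"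
  shows "\<exists>M1. wh\<^sup>*\<^sup>* M (Abs M1) \<and> head_reduces_to M1 n y Ms"
proof -
  let ?H = "absn n (apps (Var y) Ms)"
  from assms have "hred\<^sup>*\<^sup>* M (Abs ?H)" by (simp add: head_reduces_to_def)
  then have "\<exists>M1. wh\<^sup>*\<^sup>* M (Abs M1) \<and> hred\<^sup>*\<^sup>* M1 ?H"
  proof (induction rule: converse_rtranclp_induct)
    case (step M M')
    from step.IH obtain M1 where M1: "wh\<^sup>*\<^sup>* M' (Abs M1)" "hred\<^sup>*\<^sup>* M1 ?H" by blast
    from hred_imp_wh[OF step.hyps(1)] show ?case
    proof (elim disjE exE conjE)
      assume "wh M M'"
      with M1 show ?thesis by (blast intro: converse_rtranclp_into_rtranclp)
    next
      fix A B assume AB: "M = Abs A" "M' = Abs B" "hred A B"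
      with M1 have "B = M1" by (auto dest: whs_Abs)
      with AB M1 show ?thesis by (auto intro: converse_rtranclp_into_rtranclp)
    qed
  qed auto
  then show ?thesis by (simp add: head_reduces_to_def)
qed

lemma hreds_Abs: "hred\<^sup>*\<^sup>* M N \<Longrightarrow> hred\<^sup>*\<^sup>* (Abs M) (Abs N)"
  by (induction rule: rtranclp_induct) (auto intro: hred_abs rtranclp.rtrancl_into_rtrancl)

lemma whs_hreds: "wh\<^sup>*\<^sup>* M N \<Longrightarrow> hred\<^sup>*\<^sup>* M N"
  by (induction rule: rtranclp_induct) (auto dest: wh_imp_hred intro: rtranclp.rtrancl_into_rtrancl)

lemma head_reduces_to_Abs:
  "head_reduces_to (Abs M) n y Ms \<longleftrightarrow> (\<exists>m. n = Suc m \<and> head_reduces_to M m y Ms)"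
proof
  assume H: "head_reduces_to (Abs M) n y Ms"
  show "\<exists>m. n = Suc m \<and> head_reduces_to M m y Ms"
  proof (cases n)
    case 0
    with H show ?thesis by (auto dest!: head_reduces_to_0D dest: whs_Abs)
  next
    case (Suc m)
    with H show ?thesis by (auto dest!: head_reduces_to_SucD dest: whs_Abs)
  qed
qed (auto simp: head_reduces_to_def intro: hreds_Abs)

lemma head_reduces_to_neutral:
  "head_reduces_to (apps (Var x) Xs) n y Ms \<longleftrightarrow> n = 0 \<and> y = x \<and> Ms = Xs"
proof
  assume H: "head_reduces_to (apps (Var x) Xs) n y Ms"
  show "n = 0 \<and> y = x \<and> Ms = Xs"
  proof (cases n)
    case 0
    with H show ?thesis by (auto dest!: head_reduces_to_0D dest: whs_neutral)
  next
    case (Suc m)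
    with H show ?thesis by (auto dest!: head_reduces_to_SucD dest: whs_neutral)
  qed
qed (simp add: head_reduces_to_def)

lemma whs_wh: "wh\<^sup>*\<^sup>* M N \<Longrightarrow> wh M M' \<Longrightarrow> N = M \<or> wh\<^sup>*\<^sup>* M' N"
  by (erule converse_rtranclpE) (auto dest: wh_det)

lemma head_reduces_to_wh:
  assumes "wh M M'"
  shows "head_reduces_to M n y Ms \<longleftrightarrow> head_reduces_to M' n y Ms"
proof
  assume H: "head_reduces_to M n y Ms"
  show "head_reduces_to M' n y Ms"
  proof (cases n)
    case 0
    with H have "wh\<^sup>*\<^sup>* M (apps (Var y) Ms)" by (auto dest: head_reduces_to_0D)
    with assms have "wh\<^sup>*\<^sup>* M' (apps (Var y) Ms)" by (auto dest: whs_wh)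
    with 0 show ?thesis by (simp add: head_reduces_to_def whs_hreds)
  next
    case (Suc m)
    with H obtain M1 where M1: "wh\<^sup>*\<^sup>* M (Abs M1)" "head_reduces_to M1 m y Ms"
      by (auto dest: head_reduces_to_SucD)
    with assms have "wh\<^sup>*\<^sup>* M' (Abs M1)" by (auto dest: whs_wh)
    then have "hred\<^sup>*\<^sup>* M' (Abs M1)" by (rule whs_hreds)
    moreover have "hred\<^sup>*\<^sup>* (Abs M1) (Abs (absn m (apps (Var y) Ms)))"
      using M1(2) by (simp add: head_reduces_to_def hreds_Abs)
    ultimately show ?thesis using Suc by (simp add: head_reduces_to_def)
  qed
qed (use assms in \<open>auto simp: head_reduces_to_def
       intro: wh_imp_hred converse_rtranclp_into_rtranclp\<close>)

text \<open>Head normalisability together with a bound \<open>l\<close> on the number of arguments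
  in the head normal form. A tuple of width at least \<open>l\<close> in place of the head variable
  leaves these arguments in place.\<close>

inductive hn :: "nat \<Rightarrow> lterm \<Rightarrow> bool" for l where
  hn_neutral: "length Ms \<le> l \<Longrightarrow> hn l (apps (Var y) Ms)"
| hn_Abs: "hn l M \<Longrightarrow> hn l (Abs M)"
| hn_wh: "wh M N \<Longrightarrow> hn l N \<Longrightarrow> hn l M"

lemma hn_imp_has_hnf: "hn l M \<Longrightarrow> has_hnf M"
  unfolding has_hnf_def
proof (induction rule: hn.induct)
  case (hn_neutral Ms y)
  then show ?case by (auto simp: head_reduces_to_neutral)
next
  case (hn_Abs M)
  then show ?case by (auto simp: head_reduces_to_Abs)
next
  case (hn_wh M N)
  then show ?case by (auto simp: head_reduces_to_wh)
qed

text \<open>Every head step of \<open>M\<close>, and every abstraction of \<open>M\<close> that is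
  entered, is matched by a rule in the derivation of \<open>nm X\<close>, so head reduction of
  \<open>M\<close> stops. \<open>Ps\<close> collects the arguments not yet consumed.\<close>

lemma nm_apps_msubst_imp_hn: "nm X \<Longrightarrow> X = apps (msubst \<sigma> M) Ps \<Longrightarrow> \<exists>l. hn l M"
proof (induction arbitrary: \<sigma> M Ps rule: nm.induct)
  case (nm_neutralI Ms y)
  show ?case
  proof (cases M rule: wh_cases)
    case (Abs M1)
    with nm_neutralI.prems show ?thesis
    proof (cases Ps)
      case (Cons P Ps')
      have "wh (apps (Abs (msubst (up \<sigma>) M1)) (P # Ps')) (apps (subst (msubst (up \<sigma>) M1) P 0) Ps')"
        by (auto intro: wh_apps wh_beta)
      with nm_neutralI.prems Abs Cons show ?thesis by (metis msubst.simps(3) wh_neutral)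
    qed simp
  next
    case (neutral z Zs)
    then show ?thesis by (auto intro: hn.intros)
  next
    case (step M')
    with nm_neutralI.prems show ?thesis by (metis wh_apps wh_msubst wh_neutral)
  qed
next
  case (nm_AbsI N)
  show ?case
  proof (cases M rule: wh_cases)
    case (Abs M1)
    show ?thesis
    proof (cases Ps)
      case Nil
      with nm_AbsI Abs have "\<exists>l. hn l M1" using nm_AbsI.IH[of "up \<sigma>" M1 "[]"] by simp
      with Abs show ?thesis by (auto intro: hn.intros)
    next
      case (Cons P Ps')
      have "wh (apps (Abs (msubst (up \<sigma>) M1)) (P # Ps')) (apps (subst (msubst (up \<sigma>) M1) P 0) Ps')"
        by (auto intro: wh_apps wh_beta)
      with nm_AbsI.prems Abs Cons show ?thesis by (metis msubst.simps(3) wh_AbsE)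
    qed
  next
    case (neutral z Zs)
    then show ?thesis by (auto intro: hn.intros)
  next
    case (step M')
    with nm_AbsI.prems show ?thesis by (metis wh_apps wh_msubst wh_AbsE)
  qed
next
  case (nm_whI X X')
  show ?case
  proof (cases M rule: wh_cases)
    case (Abs M1)
    show ?thesis
    proof (cases Ps)
      case Nil
      with nm_whI Abs show ?thesis by auto
    next
      case (Cons P Ps')
      have "wh X (apps (msubst (case_nat P \<sigma>) M1) Ps')"
        using nm_whI.prems Abs Cons by (auto simp flip: subst_msubst_up intro: wh_apps wh_beta)
      with nm_whI.hyps have "X' = apps (msubst (case_nat P \<sigma>) M1) Ps'" by (auto dest: wh_det)
      from nm_whI.IH[OF this] Abs show ?thesis by (auto intro: hn.intros)
    qed
  next
    case (neutral z Zs)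
    then show ?thesis by (auto intro: hn.intros)
  next
    case (step M')
    with nm_whI.prems have "wh X (apps (msubst \<sigma> M') Ps)" by (simp add: wh_apps wh_msubst)
    with nm_whI.hyps have "X' = apps (msubst \<sigma> M') Ps" by (auto dest: wh_det)
    from nm_whI.IH[OF this] step show ?thesis by (auto intro: hn.intros)
  qed
qed

section \<open>Equality of Boehm trees implies observational equivalence\<close>

lemma bt_eq_sym: "bt_eq M N \<Longrightarrow> bt_eq N M"
proof (coinduction arbitrary: M N)
  case bt_eq
  then show ?case
  proof cases
    case (bt_node n y Ms Ns)
    have "list_all2 (\<lambda>x1 x2. (\<exists>M N. x1 = N \<and> x2 = M \<and> bt_eq M N) \<or> bt_eq x1 x2) Ns Ms"
      using bt_node(3) by (auto simp: list_all2_conv_all_nth)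
    with bt_node show ?thesis by blast
  qed auto
qed

text \<open>Both rules of \<open>bt_eq\<close> look at \<open>M\<close> only through its head normal
  forms, and these are the same before and after a weak head step.\<close>

lemma bt_eq_wh: "bt_eq M N \<Longrightarrow> wh M M' \<Longrightarrow> bt_eq M' N"
  by (erule bt_eq.cases) (auto simp: has_hnf_def head_reduces_to_wh intro: bt_eq.intros)

text \<open>The leaves carry related substitutions rather than bare Boehm-equal terms, so that the relation
  survives the contraction of a head redex whose abstraction comes from a leaf.\<close>

inductive btc :: "lterm \<Rightarrow> lterm \<Rightarrow> bool" where
  btc_Var: "btc (Var i) (Var i)"
| btc_App: "btc M M' \<Longrightarrow> btc N N' \<Longrightarrow> btc (App M N) (App M' N')"
| btc_Abs: "btc M N \<Longrightarrow> btc (Abs M) (Abs N)"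
| btc_bt_eq: "bt_eq M N \<Longrightarrow> (\<And>i. btc (\<sigma> i) (\<tau> i)) \<Longrightarrow> btc (msubst \<sigma> M) (msubst \<tau> N)"

lemma btc_refl: "btc M M"
  by (induction M) (auto intro: btc.intros)

lemma btc_ren: "btc M N \<Longrightarrow> btc (ren r M) (ren r N)"
proof (induction arbitrary: r rule: btc.induct)
  case (btc_bt_eq M N \<sigma> \<tau>)
  then show ?case by (auto simp: ren_msubst intro: btc.btc_bt_eq)
qed (auto intro: btc.btc_Var btc.btc_App btc.btc_Abs)

lemma btc_up: "(\<And>i. btc (\<sigma> i) (\<tau> i)) \<Longrightarrow> btc (up \<sigma> i) (up \<tau> i)"
  by (cases i) (auto intro: btc_refl btc_ren)

lemma btc_msubst:
  "btc M N \<Longrightarrow> (\<And>i. btc (\<sigma> i) (\<tau> i)) \<Longrightarrow> btc (msubst \<sigma> M) (msubst \<tau> N)"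
proof (induction arbitrary: \<sigma> \<tau> rule: btc.induct)
  case (btc_Abs M N)
  have "btc (msubst (up \<sigma>) M) (msubst (up \<tau>) N)"
    by (rule btc_Abs.IH) (rule btc_up, rule btc_Abs.prems)
  then show ?case by (simp add: btc.btc_Abs)
next
  case (btc_bt_eq M N \<sigma>' \<tau>')
  then show ?case by (auto simp: msubst_msubst intro: btc.btc_bt_eq)
qed (auto intro: btc.btc_Var btc.btc_App)

lemma btc_apps: "list_all2 btc Ps Qs \<Longrightarrow> btc M N \<Longrightarrow> btc (apps M Ps) (apps N Qs)"
  by (induction arbitrary: M N rule: list_all2_induct) (auto intro: btc_App)

lemma btc_subst: "btc M N \<Longrightarrow> btc P Q \<Longrightarrow> btc (subst M P 0) (subst N Q 0)"
  unfolding subst_conv_msubst by (erule btc_msubst) (simp add: btc_refl split: nat.split)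

text \<open>Two nested inductions. The outer one, on \<open>nm X\<close>, enters as
  \<open>IHw\<close>, \<open>IHa\<close> and \<open>IHn\<close>; the inner one follows the
  derivation relating the heads. A leaf with head variable \<open>y\<close> hands control to
  \<sigma> \<open>y\<close> without changing \<open>X\<close>, so there only the inner derivation
  shrinks.\<close>

lemma btc_apps_nm:
  assumes nm: "nm X"
    and IHw: "\<And>X' Y. wh X X' \<Longrightarrow> btc X' Y \<Longrightarrow> nm Y"
    and IHa: "\<And>X1 Y. X = Abs X1 \<Longrightarrow> btc X1 Y \<Longrightarrow> nm Y"
    and IHn: "\<And>y Ms M Y. X = apps (Var y) Ms \<Longrightarrow> M \<in> set Ms \<Longrightarrow> btc M Y \<Longrightarrow> nm Y"
  shows "btc H K \<Longrightarrow> list_all2 btc Ps Qs \<Longrightarrow> X = apps H Ps \<Longrightarrow> nm (apps K Qs)"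
proof (induction arbitrary: Ps Qs rule: btc.induct)
  case (btc_Var i)
  have "nm Q" if "Q \<in> set Qs" for Q
    using that btc_Var IHn by (metis in_set_conv_nth list_all2_conv_all_nth)
  then show ?case by simp
next
  case (btc_App M M' N N')
  then show ?case using btc_App.IH(1)[of "N # Ps" "N' # Qs"] by simp
next
  case (btc_Abs M N)
  show ?case
  proof (cases Ps)
    case Nil
    with btc_Abs IHa show ?thesis by auto
  next
    case (Cons P Ps')
    with btc_Abs.prems obtain Q Qs' where Q: "Qs = Q # Qs'" "btc P Q" "list_all2 btc Ps' Qs'"
      by (auto simp: list_all2_Cons1)
    have "wh X (apps (subst M P 0) Ps')"
      using btc_Abs.prems Cons by (auto intro: wh_apps wh_beta)
    moreover have "btc (apps (subst M P 0) Ps') (apps (subst N Q 0) Qs')"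
      using Q btc_Abs.hyps by (auto intro: btc_apps btc_subst)
    ultimately have "nm (apps (subst N Q 0) Qs')" by (rule IHw)
    moreover have "wh (apps (Abs N) Qs) (apps (subst N Q 0) Qs')"
      unfolding Q by (auto intro: wh_apps wh_beta)
    ultimately show ?thesis by (simp add: nm_wh)
  qed
next
  case (btc_bt_eq M N \<sigma> \<tau>)
  \<comment> \<open>Normalisation of \<open>X\<close> excludes the bottom case, so the two Boehm
    trees share a root node.\<close>
  have "has_hnf M"
    using nm_apps_msubst_imp_hn[OF nm btc_bt_eq.prems(2)] hn_imp_has_hnf by blast
  with btc_bt_eq.hyps(1) obtain n y Ms Ns where
    M: "head_reduces_to M n y Ms" and N: "head_reduces_to N n y Ns" and
    MN: "list_all2 bt_eq Ms Ns"
    by cases auto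
  show ?case
  proof (cases M rule: wh_cases)
    case (Abs M1)
    with M obtain m where m: "n = Suc m" "head_reduces_to M1 m y Ms"
      by (auto simp: head_reduces_to_Abs)
    with N obtain N1 where N1: "wh\<^sup>*\<^sup>* N (Abs N1)" "head_reduces_to N1 m y Ns"
      by (auto dest: head_reduces_to_SucD)
    from m(2) N1(2) MN have bt: "bt_eq M1 N1" by (rule bt_node)
    have red: "wh\<^sup>*\<^sup>* (apps (msubst \<tau> N) Qs) (apps (Abs (msubst (up \<tau>) N1)) Qs)"
      using whs_apps[OF whs_msubst[OF N1(1)], of \<tau> Qs] by simp
    show ?thesis
    proof (cases Ps)
      case Nil
      have "btc (msubst (up \<sigma>) M1) (msubst (up \<tau>) N1)"
        using bt by (rule btc.btc_bt_eq) (rule btc_up, rule btc_bt_eq.hyps)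
      moreover have "X = Abs (msubst (up \<sigma>) M1)" using btc_bt_eq.prems Nil Abs by simp
      ultimately have "nm (msubst (up \<tau>) N1)" by (auto intro: IHa)
      moreover have "Qs = []" using Nil btc_bt_eq.prems by simp
      ultimately show ?thesis using nm_whs[OF red] by simp
    next
      case (Cons P Ps')
      with btc_bt_eq.prems obtain Q Qs' where
        Q: "Qs = Q # Qs'" "btc P Q" "list_all2 btc Ps' Qs'"
        by (auto simp: list_all2_Cons1)
      have "wh X (apps (msubst (case_nat P \<sigma>) M1) Ps')"
        using btc_bt_eq.prems Abs Cons
        by (auto simp flip: subst_msubst_up intro: wh_apps wh_beta)
      moreover have "btc (msubst (case_nat P \<sigma>) M1) (msubst (case_nat Q \<tau>) N1)"
        using bt by (rule btc.btc_bt_eq) (simp add: Q btc_bt_eq.hyps split: nat.split)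
      then have "btc (apps (msubst (case_nat P \<sigma>) M1) Ps') (apps (msubst (case_nat Q \<tau>) N1) Qs')"
        using Q by (auto intro: btc_apps)
      ultimately have "nm (apps (msubst (case_nat Q \<tau>) N1) Qs')" by (rule IHw)
      moreover have "wh (apps (Abs (msubst (up \<tau>) N1)) Qs) (apps (msubst (case_nat Q \<tau>) N1) Qs')"
        unfolding Q by (auto simp flip: subst_msubst_up intro: wh_apps wh_beta)
      ultimately show ?thesis using nm_whs[OF red] by (simp add: nm_wh)
    qed
  next
    case (neutral z Zs)
    with M have nz: "n = 0" "M = apps (Var y) Ms" by (auto simp: head_reduces_to_neutral)
    with N have "wh\<^sup>*\<^sup>* N (apps (Var y) Ns)" by (auto dest: head_reduces_to_0D)
    from whs_apps[OF whs_msubst[OF this], of \<tau> Qs]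
    have red: "wh\<^sup>*\<^sup>* (apps (msubst \<tau> N) Qs) (apps (\<tau> y) (map (msubst \<tau>) Ns @ Qs))"
      by (simp add: msubst_apps apps_append)
    have "list_all2 btc (map (msubst \<sigma>) Ms @ Ps) (map (msubst \<tau>) Ns @ Qs)"
    proof (rule list_all2_appendI)
      show "list_all2 btc (map (msubst \<sigma>) Ms) (map (msubst \<tau>) Ns)"
        using MN btc_bt_eq.hyps by (auto simp: list_all2_conv_all_nth intro!: btc.btc_bt_eq)
    qed (rule btc_bt_eq.prems)
    moreover have "X = apps (\<sigma> y) (map (msubst \<sigma>) Ms @ Ps)"
      using btc_bt_eq.prems nz by (simp add: msubst_apps apps_append)
    ultimately have "nm (apps (\<tau> y) (map (msubst \<tau>) Ns @ Qs))" by (rule btc_bt_eq.IH)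
    then show ?thesis by (simp add: nm_whs[OF red])
  next
    case (step M')
    with btc_bt_eq.prems have "wh X (apps (msubst \<sigma> M') Ps)" by (simp add: wh_apps wh_msubst)
    moreover have "btc (apps (msubst \<sigma> M') Ps) (apps (msubst \<tau> N) Qs)"
      using btc_bt_eq.prems(1)
    proof (rule btc_apps)
      show "btc (msubst \<sigma> M') (msubst \<tau> N)"
        using bt_eq_wh[OF btc_bt_eq.hyps(1) step] btc_bt_eq.hyps by (blast intro: btc.btc_bt_eq)
    qed
    ultimately show ?thesis by (rule IHw)
  qed
qed

lemma btc_nm: "nm X \<Longrightarrow> btc X Y \<Longrightarrow> nm Y"
proof (induction arbitrary: Y rule: nm.induct)
  case (nm_neutralI Ms y)
  have "nm (apps (Var y) Ms)" using nm_neutralI.hyps by simp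
  then show ?case
    by (rule btc_apps_nm[where Ps = "[]" and Qs = "[]", simplified])
       (use nm_neutralI in auto)
next
  case (nm_AbsI M)
  have "nm (Abs M)" using nm_AbsI.hyps by simp
  then show ?case
    by (rule btc_apps_nm[where Ps = "[]" and Qs = "[]", simplified])
       (use nm_AbsI in auto)
next
  case (nm_whI M N)
  have "nm M" using nm_whI.hyps by (rule nm.nm_whI)
  then show ?case
    by (rule btc_apps_nm[where Ps = "[]" and Qs = "[]", simplified])
       (use nm_whI in \<open>auto dest: wh_det\<close>)
qed

lemma btc_plug: "btc M N \<Longrightarrow> btc (plug C M) (plug C N)"
  by (induction C) (auto intro: btc.btc_Var btc.btc_App btc.btc_Abs)

theorem bt_eq_imp_hplus:
  assumes "bt_eq M N"
  shows "hplus M N"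
proof -
  have btc: "btc M N" if "bt_eq M N" for M N
    using btc_bt_eq[OF that, of Var Var] by (simp add: btc_refl)
  then have "btc M N" "btc N M" using assms bt_eq_sym by blast+
  then show ?thesis unfolding hplus_nm by (blast intro: btc_nm btc_plug)
qed

section \<open>A context lemma for closed terms\<close>

text \<open>Contexts are not stable under contraction of a redex, but this relation between their
  instances is, for closed \<open>M\<close> and \<open>N\<close>, whose copies need no shifting
  below binders.\<close>

inductive repl :: "lterm \<Rightarrow> lterm \<Rightarrow> lterm \<Rightarrow> lterm \<Rightarrow> bool" for M N where
  repl_base: "repl M N M N"
| repl_Var: "repl M N (Var i) (Var i)"
| repl_App: "repl M N P P' \<Longrightarrow> repl M N Q Q' \<Longrightarrow> repl M N (App P Q) (App P' Q')"
| repl_Abs: "repl M N P Q \<Longrightarrow> repl M N (Abs P) (Abs Q)"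

inductive_cases repl_AbsE: "repl M N (Abs P) Q"

lemma repl_refl: "repl M N P P"
  by (induction P) (auto intro: repl.intros)

lemma repl_plug: "repl M N (plug C M) (plug C N)"
  by (induction C) (auto intro: repl.intros)

lemma repl_apps: "list_all2 (repl M N) Ps Qs \<Longrightarrow> repl M N P Q \<Longrightarrow> repl M N (apps P Ps) (apps Q Qs)"
  by (induction arbitrary: P Q rule: list_all2_induct) (auto intro: repl_App)

lemma repl_ren:
  "repl M N P Q \<Longrightarrow> closed M \<Longrightarrow> closed N \<Longrightarrow> repl M N (ren r P) (ren r Q)"
  by (induction arbitrary: r rule: repl.induct) (auto simp: ren_closed intro: repl.intros)

lemma repl_msubst:
  "repl M N P Q \<Longrightarrow> closed M \<Longrightarrow> closed N \<Longrightarrow> (\<And>i. repl M N (\<sigma> i) (\<tau> i)) \<Longrightarrow>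
    repl M N (msubst \<sigma> P) (msubst \<tau> Q)"
proof (induction arbitrary: \<sigma> \<tau> rule: repl.induct)
  case repl_base
  then show ?case by (simp add: msubst_closed repl.repl_base)
next
  case (repl_Abs P Q)
  have "repl M N (up \<sigma> i) (up \<tau> i)" for i
    using repl_Abs.prems by (cases i) (auto intro: repl_refl repl_ren)
  then show ?case using repl_Abs by (auto intro: repl.intros)
qed (auto intro: repl.intros)

lemma repl_subst:
  "repl M N P Q \<Longrightarrow> repl M N P' Q' \<Longrightarrow> closed M \<Longrightarrow> closed N \<Longrightarrow>
    repl M N (subst P P' 0) (subst Q Q' 0)"
  unfolding subst_conv_msubst by (erule repl_msubst) (auto simp: repl_refl split: nat.split)

lemma not_closed_neutral: "\<not> closed (apps (Var y) Ms)"
  by (simp add: closed_def closed_at_apps)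

lemma repl_neutral:
  "repl M N (apps (Var y) Ms) Q \<Longrightarrow> closed M \<Longrightarrow>
    \<exists>Ns. Q = apps (Var y) Ns \<and> list_all2 (repl M N) Ms Ns"
proof (induction Ms arbitrary: Q rule: rev_induct)
  case Nil
  from Nil(1) have "Q = apps (Var y) []"
    by cases (use Nil(2) not_closed_neutral[of y "[]"] in auto)
  then show ?case by blast
next
  case (snoc P Ms)
  from snoc.prems(1) have "repl M N (App (apps (Var y) Ms) P) Q" by (simp add: apps_snoc)
  then show ?case
  proof cases
    case repl_base
    with snoc.prems not_closed_neutral[of y "Ms @ [P]"] show ?thesis by (simp add: apps_snoc)
  next
    case (repl_App A B)
    with snoc obtain Ns where "A = apps (Var y) Ns" "list_all2 (repl M N) Ms Ns" by blast
    with repl_App have "Q = apps (Var y) (Ns @ [B])" "list_all2 (repl M N) (Ms @ [P]) (Ns @ [B])"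
      by (auto simp: apps_snoc list_all2_appendI)
    then show ?thesis by blast
  qed
qed

text \<open>A step is copied on the right unless a replaced \<open>M\<close> stands at the head,
  where \<open>M\<close> and \<open>N\<close> may behave differently.\<close>

lemma repl_wh:
  "repl M N P Q \<Longrightarrow> closed M \<Longrightarrow> closed N \<Longrightarrow> wh P P' \<Longrightarrow>
    (\<exists>Q'. wh Q Q' \<and> repl M N P' Q') \<or>
    (\<exists>Ps Qs. P = apps M Ps \<and> Q = apps N Qs \<and> list_all2 (repl M N) Ps Qs)"
proof (induction arbitrary: P' rule: repl.induct)
  case repl_base
  have "M = apps M []" "N = apps N []" "list_all2 (repl M N) [] []" by simp_all
  then show ?case by blast
next
  case (repl_App A A' B B')
  from repl_App.prems(3) show ?case
  proof (rule wh_AppE)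
    fix s assume s: "A = Abs s" "P' = subst s B 0"
    with repl_App.hyps have "repl M N (Abs s) A'" by simp
    then show ?thesis
    proof (rule repl_AbsE)
      assume "Abs s = M" "A' = N"
      with s repl_App.hyps have "App A B = apps M [B]" "App A' B' = apps N [B']"
        "list_all2 (repl M N) [B] [B']" by simp_all
      then show ?thesis by blast
    next
      fix s' assume s': "A' = Abs s'" "repl M N s s'"
      have "repl M N P' (subst s' B' 0)" unfolding s
        using s'(2) repl_App by (blast intro: repl_subst)
      moreover have "wh (App A' B') (subst s' B' 0)" unfolding s' by (rule wh_beta)
      ultimately show ?thesis by (intro disjI1 exI[of _ "subst s' B' 0"] conjI)
    qed
  next
    fix A1 assume A1: "P' = App A1 B" "wh A A1"
    from repl_App.IH(1)[OF repl_App.prems(1,2) A1(2)] show ?thesis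
    proof (elim disjE exE conjE)
      fix A2 assume "wh A' A2" "repl M N A1 A2"
      with A1 repl_App.hyps show ?thesis by (blast intro: wh_app repl.repl_App)
    next
      fix Ps Qs assume "A = apps M Ps" "A' = apps N Qs" "list_all2 (repl M N) Ps Qs"
      then have "App A B = apps M (Ps @ [B])" "App A' B' = apps N (Qs @ [B'])"
        "list_all2 (repl M N) (Ps @ [B]) (Qs @ [B'])"
        using repl_App.hyps by (simp_all add: apps_snoc list_all2_appendI)
      then show ?thesis by blast
    qed
  qed
qed auto

text \<open>If the head copy of \<open>M\<close> is kept and only its arguments are replaced, the
  step acts inside \<open>M\<close> or feeds it one argument, and can be copied.\<close>

lemma repl_wh_head:
  assumes "closed M" "closed N" "wh (apps M Ps) P'" "list_all2 (repl M N) Ps Qs"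
  shows "\<exists>Q'. wh (apps M Qs) Q' \<and> repl M N P' Q'"
proof (cases M rule: wh_cases)
  case (Abs M1)
  show ?thesis
  proof (cases Ps)
    case Nil
    with assms Abs show ?thesis by auto
  next
    case (Cons P Ps')
    with assms(4) obtain Q Qs' where Q: "Qs = Q # Qs'" "repl M N P Q" "list_all2 (repl M N) Ps' Qs'"
      by (auto simp: list_all2_Cons1)
    have "wh (apps M Ps) (apps (subst M1 P 0) Ps')" "wh (apps M Qs) (apps (subst M1 Q 0) Qs')"
      unfolding Abs Cons Q by (auto intro: wh_apps wh_beta)
    moreover have "repl M N (apps (subst M1 P 0) Ps') (apps (subst M1 Q 0) Qs')"
      using Q assms by (auto intro: repl_apps repl_subst repl_refl)
    ultimately show ?thesis using assms(3) by (blast dest: wh_det)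
  qed
next
  case (neutral y Ms)
  with assms(1) not_closed_neutral show ?thesis by auto
next
  case (step M')
  then have "wh (apps M Ps) (apps M' Ps)" "wh (apps M Qs) (apps M' Qs)" by (simp_all add: wh_apps)
  moreover have "repl M N (apps M' Ps) (apps M' Qs)"
    using assms(4) by (auto intro: repl_apps repl_refl)
  ultimately show ?thesis using assms(3) by (blast dest: wh_det)
qed

lemma repl_nm:
  assumes closed: "closed M" "closed N"
    and app: "\<And>Ps. nm (apps M Ps) \<Longrightarrow> nm (apps N Ps)"
  shows "nm P \<Longrightarrow> repl M N P Q \<Longrightarrow> nm Q"
proof (induction arbitrary: Q rule: nm.induct)
  case (nm_neutralI Ms y)
  from repl_neutral[OF nm_neutralI.prems closed(1)] obtain Ns where
    Ns: "Q = apps (Var y) Ns" "list_all2 (repl M N) Ms Ns" by blast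
  have "nm R" if "R \<in> set Ns" for R
    using that Ns(2) nm_neutralI.IH by (metis in_set_conv_nth list_all2_conv_all_nth)
  with Ns show ?case by simp
next
  case (nm_AbsI P)
  from nm_AbsI.prems show ?case
  proof (rule repl_AbsE)
    assume "Abs P = M" "Q = N"
    with app[of "[]"] nm_AbsI.hyps show ?thesis by auto
  next
    fix Q1 assume "Q = Abs Q1" "repl M N P Q1"
    with nm_AbsI.IH show ?thesis by simp
  qed
next
  case (nm_whI P P')
  from repl_wh[OF nm_whI.prems closed nm_whI.hyps(1)] show ?case
  proof (elim disjE exE conjE)
    fix Q' assume "wh Q Q'" "repl M N P' Q'"
    with nm_whI.IH show ?thesis by (simp add: nm_wh)
  next
    fix Ps Qs assume PQ: "P = apps M Ps" "Q = apps N Qs" "list_all2 (repl M N) Ps Qs"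
    with repl_wh_head[OF closed _ PQ(3)] nm_whI.hyps obtain Q' where
      "wh (apps M Qs) Q'" "repl M N P' Q'" by blast
    \<comment> \<open>The head copy of \<open>M\<close> is kept while the induction hypothesis deals
      with the arguments; only afterwards does \<open>app\<close> exchange it for
      \<open>N\<close>.\<close>
    with nm_whI.IH have "nm (apps M Qs)" by (simp add: nm_wh)
    with app PQ show ?thesis by simp
  qed
qed

lemma context_lemma:
  assumes "closed M" "closed N" and "\<And>Ps. nm (apps M Ps) \<longleftrightarrow> nm (apps N Ps)"
  shows "hplus M N"
proof -
  have "nm (plug C N)" if "nm (plug C M)" for C
    using repl_nm[OF assms(1,2) _ that repl_plug] assms(3) by blast
  moreover have "nm (plug C M)" if "nm (plug C N)" for C
    using repl_nm[OF assms(2,1) _ that repl_plug] assms(3) by blast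
  ultimately show ?thesis unfolding hplus_nm by blast
qed

section \<open>Normalisation and variables\<close>

text \<open>Rule induction on the normalisation of an instance, but read off from \<open>B\<close>
  itself. If \<rho> puts a non-variable at the head, the neutral case comes without induction
  hypotheses.\<close>

lemma nm_msubst_induct [consumes 1, case_names wh Abs neutral]:
  assumes "nm (msubst \<rho> B)"
    and wh: "\<And>\<rho> B B'. wh B B' \<Longrightarrow> Q \<rho> B' \<Longrightarrow> Q \<rho> B"
    and Abs: "\<And>\<rho> B. Q (up \<rho>) B \<Longrightarrow> Q \<rho> (Abs B)"
    and neutral: "\<And>\<rho> y Bs. (\<And>x B. \<rho> y = Var x \<Longrightarrow> B \<in> set Bs \<Longrightarrow> Q \<rho> B) \<Longrightarrow>
      Q \<rho> (apps (Var y) Bs)"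
  shows "Q \<rho> B"
proof -
  have "Q \<rho> B" if "nm X" "X = msubst \<rho> B" for X
    using that
  proof (induction arbitrary: \<rho> B rule: nm.induct)
    case (nm_neutralI Ms y)
    show ?case
    proof (cases B rule: wh_cases)
      case (Abs B1)
      with nm_neutralI.prems show ?thesis by simp
    next
      case B: (neutral z Bs)
      show ?thesis
        unfolding B
      proof (rule neutral)
        fix x B' assume "\<rho> z = Var x" "B' \<in> set Bs"
        with nm_neutralI B show "Q \<rho> B'" by (auto simp: msubst_apps)
      qed
    next
      case (step B')
      with nm_neutralI.prems show ?thesis by (metis wh_msubst wh_neutral)
    qed
  next
    case (nm_AbsI M)
    show ?case
    proof (cases B rule: wh_cases)
      case (Abs B1)
      with nm_AbsI show ?thesis by (simp add: assms(3))
    next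
      case B: (neutral z Bs)
      show ?thesis
        unfolding B
      proof (rule neutral)
        fix x B' assume "\<rho> z = Var x"
        with nm_AbsI.prems B show "Q \<rho> B'" by (simp add: msubst_apps)
      qed
    next
      case (step B')
      with nm_AbsI.prems show ?thesis by (metis wh_msubst wh_AbsE)
    qed
  next
    case (nm_whI M M')
    show ?case
    proof (cases B rule: wh_cases)
      case (Abs B1)
      with nm_whI show ?thesis by auto
    next
      case B: (neutral z Bs)
      show ?thesis
        unfolding B
      proof (rule neutral)
        fix x B' assume "\<rho> z = Var x"
        with nm_whI B show "Q \<rho> B'" by (simp add: msubst_apps)
      qed
    next
      case (step B')
      with nm_whI have "M' = msubst \<rho> B'" by (blast dest: wh_det wh_msubst)
      with nm_whI.IH step show ?thesis by (blast intro: wh)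
    qed
  qed
  with assms(1) show ?thesis by blast
qed

lemma nm_ren: "nm M \<Longrightarrow> nm (ren r M)"
proof (induction arbitrary: r rule: nm.induct)
  case (nm_whI M N)
  then show ?case by (blast intro: nm.nm_whI wh_ren)
qed (auto simp: ren_apps)

text \<open>Contraction with a variable as argument renames the body, which neither creates nor
  destroys redexes. Argument lists may therefore be padded with variables.\<close>

lemma nm_App_Var: "nm (App M (Var i)) \<longleftrightarrow> nm M"
proof
  assume "nm M"
  then show "nm (App M (Var i))"
  proof induction
    case (nm_neutralI Ms y)
    then have "nm (apps (Var y) (Ms @ [Var i]))" unfolding nm_neutral by auto
    then show ?case by (simp add: apps_snoc)
  next
    case (nm_AbsI M)
    have "case_nat (Var i) Var = (\<lambda>j. Var (case_nat i id j))" by (auto split: nat.split)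
    then have "subst M (Var i) 0 = ren (case_nat i id) M"
      by (simp add: subst_conv_msubst ren_conv_msubst)
    moreover have "nm (ren (case_nat i id) M)" using nm_AbsI.hyps by (rule nm_ren)
    ultimately show ?case by (simp add: nm_wh[OF wh_beta])
  next
    case (nm_whI M N)
    then show ?case by (blast intro: nm.nm_whI wh_app)
  qed
next
  \<comment> \<open>The renaming may identify variables and so has no inverse; reflection is proved
    by induction on the instance.\<close>
  have nm_ren_imp: "nm M" if "nm (msubst (\<lambda>j. Var (r j)) M)" for r M
  proof -
    have "(\<forall>j. \<exists>x. \<rho> j = Var x) \<longrightarrow> nm M" if "nm (msubst \<rho> M)" for \<rho> M
      using that
    proof (induction rule: nm_msubst_induct)
      case (wh \<rho> B B')
      then show ?case by (blast intro: nm_whI)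
    next
      case (Abs \<rho> B)
      show ?case
      proof
        assume "\<forall>j. \<exists>x. \<rho> j = Var x"
        then have "\<exists>x. up \<rho> j = Var x" for j by (cases j) (auto, metis ren.simps(1))
        with Abs show "nm (Abs B)" by simp
      qed
    next
      case (neutral \<rho> y Bs)
      show ?case
      proof
        assume vars: "\<forall>j. \<exists>x. \<rho> j = Var x"
        then obtain x where "\<rho> y = Var x" by blast
        with neutral vars show "nm (apps (Var y) Bs)" by simp
      qed
    qed
    with that show ?thesis by blast
  qed
  have "nm M" if "nm X" "X = App M (Var i)" for X
    using that
  proof (induction arbitrary: M rule: nm.induct)
    case (nm_neutralI Ms y)
    show ?case
    proof (cases Ms rule: rev_cases)
      case (snoc Ms' P)
      with nm_neutralI have "M = apps (Var y) Ms'" by (simp add: apps_snoc)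
      moreover have "nm P" if "P \<in> set Ms'" for P using nm_neutralI snoc that by simp
      ultimately show ?thesis by simp
    qed (use nm_neutralI in simp)
  next
    case (nm_whI X X')
    from nm_whI.hyps(1) nm_whI.prems have "wh (App M (Var i)) X'" by simp
    then show ?case
    proof (rule wh_AppE)
      fix s assume s: "M = Abs s" "X' = subst s (Var i) 0"
      have "case_nat (Var i) Var = (\<lambda>j. Var (case_nat i id j))" by (auto split: nat.split)
      with s nm_whI.hyps(2) have "nm (msubst (\<lambda>j. Var (case_nat i id j)) s)"
        by (simp add: subst_conv_msubst)
      then have "nm s" by (rule nm_ren_imp)
      with s show ?thesis by simp
    next
      fix s assume "X' = App s (Var i)" "wh M s"
      with nm_whI.IH show ?thesis by (blast intro: nm.nm_whI)
    qed
  qed simp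
  then show "nm M" if "nm (App M (Var i))" using that by blast
qed

lemma nm_apps_Vars: "nm (apps M (replicate n (Var i))) \<longleftrightarrow> nm M"
  by (induction n arbitrary: M) (simp_all add: nm_App_Var)

section \<open>Tupling combinators\<close>

text \<open>The last argument is bound to index 0, hence the reversed position
  \<open>n - Suc i\<close>; the induction splits off that last argument.\<close>

lemma betas_apps_absn:
  "length ts = n \<Longrightarrow> beta\<^sup>*\<^sup>* (apps (absn n M) ts)
    (msubst (\<lambda>i. if i < n then ts ! (n - Suc i) else Var (i - n)) M)"
proof (induction n arbitrary: ts M)
  case (Suc n)
  then obtain ts' t where ts: "ts = ts' @ [t]" "length ts' = n"
    by (cases ts rule: rev_cases) auto
  let ?s = "\<lambda>i. if i < n then ts' ! (n - Suc i) else Var (i - n)"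
  have "beta\<^sup>*\<^sup>* (apps (absn n (Abs M)) ts') (msubst ?s (Abs M))"
    using Suc.IH ts(2) by blast
  then have "beta\<^sup>*\<^sup>* (App (apps (absn n (Abs M)) ts') t) (App (Abs (msubst (up ?s) M)) t)"
    by (simp add: betas_App)
  moreover have "beta (App (Abs (msubst (up ?s) M)) t) (msubst (case_nat t ?s) M)"
    using beta_red[of "msubst (up ?s) M" t] by (simp add: subst_msubst_up)
  moreover have "case_nat t ?s = (\<lambda>i. if i < Suc n then ts ! (Suc n - Suc i) else Var (i - Suc n))"
  proof
    fix i show "case_nat t ?s i = (if i < Suc n then ts ! (Suc n - Suc i) else Var (i - Suc n))"
      using ts by (cases i) (simp_all add: nth_append)
  qed
  ultimately show ?case
    using ts(1) by (simp add: absn_Suc_right apps_snoc del: absn_Suc)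
qed simp

definition Omega :: lterm where
  "Omega = App (Abs (App (Var 0) (Var 0))) (Abs (App (Var 0) (Var 0)))"

lemma not_nm_Omega: "\<not> nm (apps Omega Ps)"
proof -
  have "wh Omega Omega"
    using wh_beta[of "App (Var 0) (Var 0)" "Abs (App (Var 0) (Var 0))"] by (simp add: Omega_def)
  then have loop: "wh (apps Omega Ps) (apps Omega Ps)" by (rule wh_apps)
  have "X \<noteq> apps Omega Ps" if "nm X" for X
    using that
  proof induction
    case (nm_neutralI Ms y)
    with loop show ?case by (metis wh_neutral)
  next
    case (nm_AbsI M)
    from loop show ?case by (metis wh_AbsE)
  next
    case (nm_whI M N)
    with loop show ?case by (auto dest: wh_det)
  qed
  then show ?thesis by blast
qed

text \<open>\<open>tup p\<close> is \<open>\<lambda>y\<^sub>1 \<dots> y\<^sub>p z. z y\<^sub>1 \<dots> y\<^sub>p\<close>.\<close>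

definition tup :: "nat \<Rightarrow> lterm" where
  "tup p = absn (Suc p) (apps (Var 0) (map (\<lambda>i. Var (p - i)) [0..<p]))"

lemma closed_tup: "closed (tup p)"
  by (auto simp: tup_def closed_def closed_at_absn closed_at_apps simp del: absn_Suc)

lemma msubst_tup [simp]: "msubst \<sigma> (tup p) = tup p"
  and ren_tup [simp]: "ren r (tup p) = tup p"
  by (simp_all add: closed_tup msubst_closed ren_closed)

lemma betas_apps_right: "beta\<^sup>*\<^sup>* M N \<Longrightarrow> beta\<^sup>*\<^sup>* (apps M Ps) (apps N Ps)"
  by (rule betas_apps) (simp_all add: list_all2_same)

lemma betas_tup:
  assumes "length Xs = p"
  shows "beta\<^sup>*\<^sup>* (apps (tup p) (Xs @ Z # Ys)) (apps Z (Xs @ Ys))"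
proof -
  let ?s = "\<lambda>i. if i < Suc p then (Xs @ [Z]) ! (Suc p - Suc i) else Var (i - Suc p)"
  have "beta\<^sup>*\<^sup>* (apps (tup p) (Xs @ [Z])) (msubst ?s (apps (Var 0) (map (\<lambda>i. Var (p - i)) [0..<p])))"
    unfolding tup_def using assms by (intro betas_apps_absn) simp
  also have "msubst ?s (apps (Var 0) (map (\<lambda>i. Var (p - i)) [0..<p])) = apps Z Xs"
  proof -
    have "map (msubst ?s) (map (\<lambda>i. Var (p - i)) [0..<p]) = Xs"
      using assms by (intro nth_equalityI) (auto simp: nth_append)
    then show ?thesis using assms by (simp only: msubst_apps) (simp add: nth_append)
  qed
  finally have "beta\<^sup>*\<^sup>* (apps (apps (tup p) (Xs @ [Z])) Ys) (apps (apps Z Xs) Ys)"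
    by (rule betas_apps_right)
  then show ?thesis by (simp flip: apps_append)
qed

text \<open>Until its selector arrives, a tuple only stores its arguments. Padding with variables up
  to the width and passing a variable as selector places them below a variable head.\<close>

lemma nm_tup:
  assumes "length Xs \<le> p"
  shows "nm (apps (tup p) Xs) \<longleftrightarrow> (\<forall>X\<in>set Xs. nm X)"
proof -
  let ?Vs = "replicate (p - length Xs) (Var 0)"
  have "nm (apps (tup p) Xs) \<longleftrightarrow> nm (apps (tup p) (Xs @ replicate (Suc (p - length Xs)) (Var 0)))"
    by (simp only: apps_append nm_apps_Vars)
  also have "Xs @ replicate (Suc (p - length Xs)) (Var 0) = (Xs @ ?Vs) @ [Var 0]"
    by (simp add: replicate_append_same)
  also have "nm (apps (tup p) \<dots>) \<longleftrightarrow> nm (apps (Var 0) (Xs @ ?Vs))"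
    using betas_tup[of "Xs @ ?Vs" p "Var 0" "[]"] assms by (intro nm_betas) simp
  also have "\<dots> \<longleftrightarrow> (\<forall>X\<in>set Xs. nm X)" unfolding nm_neutral by auto
  finally show ?thesis .
qed

text \<open>\<open>a\<close> and \<open>b\<close> count the arguments still missing before the
  selector. The common list \<open>Us\<close> has an eraser in slot \<open>a\<close> and
  \<open>Omega\<close> in slot \<open>b\<close>, so exactly the left side normalises.\<close>

lemma not_hplus_tup:
  assumes a: "length As + a = p" and b: "length Bs + b = q" and "a \<noteq> b"
  shows "\<not> hplus (apps (tup p) As) (apps (tup q) Bs)"
proof
  assume H: "hplus (apps (tup p) As) (apps (tup q) Bs)"
  \<comment> \<open>The eraser receives the \<open>p\<close> stored arguments and the
    \<open>max a b - a\<close> entries of \<open>Us\<close> behind it.\<close>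
  define n where "n = p + (max a b - a)"
  define Us where "Us = (replicate (Suc (max a b)) Omega)[a := absn n (Abs (Var 0))]"
  have len: "length Us = Suc (max a b)" by (simp add: Us_def del: replicate_Suc)
  have Us_a: "Us ! a = absn n (Abs (Var 0))" by (simp add: Us_def del: replicate_Suc)
  have Us_b: "Us ! b = Omega" using \<open>a \<noteq> b\<close> by (simp add: Us_def del: replicate_Suc)
  have red: "beta\<^sup>*\<^sup>* (apps (tup r) (Cs @ Us)) (apps (Us ! c) (Cs @ take c Us @ drop (Suc c) Us))"
    if "length Cs + c = r" "c \<le> max a b" for r c Cs
  proof -
    have "Us = take c Us @ Us ! c # drop (Suc c) Us"
      using that len by (simp add: id_take_nth_drop)
    moreover have "length (Cs @ take c Us) = r" using that len by simp
    ultimately show ?thesis using betas_tup[of "Cs @ take c Us" r "Us ! c" "drop (Suc c) Us"] by simp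
  qed
  let ?Ts = "As @ take a Us @ drop (Suc a) Us"
  have "length ?Ts = n" using a len by (simp add: n_def)
  from betas_apps_absn[OF this, of "Abs (Var 0)"] have "nm (apps (Us ! a) ?Ts)"
    unfolding Us_a by (simp add: nm_betas)
  with red[OF a] have "nm (apps (tup p) (As @ Us))" by (simp add: nm_betas)
  moreover have "hplus (apps (tup p) (As @ Us)) (apps (tup q) (Bs @ Us))"
    using hplus_apps[OF H] by (simp add: apps_append)
  ultimately have "nm (apps (tup q) (Bs @ Us))" by (simp add: hplus_nmD)
  with red[OF b] have "nm (apps (Us ! b) (Bs @ take b Us @ drop (Suc b) Us))"
    by (simp add: nm_betas)
  then show False unfolding Us_b by (simp only: not_nm_Omega)
qed

section \<open>Boehming out with tuples\<close>

text \<open>Closing substitutions with widths chosen independently at each variable. They are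
  bounded only from below, so that bounds can be raised as arguments are extracted.\<close>

definition full :: "(nat \<Rightarrow> nat) \<Rightarrow> (nat \<Rightarrow> lterm) \<Rightarrow> bool" where
  "full P \<sigma> \<longleftrightarrow> (\<forall>i. \<exists>p\<ge>P i. \<sigma> i = tup p)"

text \<open>An index mapped to a variable is subject to no bound. Raising \<open>P\<close> there
  costs nothing, which gives the eta-expansion argument its room.\<close>

definition part :: "(nat \<Rightarrow> nat) \<Rightarrow> (nat \<Rightarrow> lterm) \<Rightarrow> bool" where
  "part P \<sigma> \<longleftrightarrow> (\<forall>i. (\<exists>x. \<sigma> i = Var x) \<or> (\<exists>p\<ge>P i. \<sigma> i = tup p))"

lemma full_tup: "(\<And>i. P i \<le> p i) \<Longrightarrow> full P (\<lambda>i. tup (p i))"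
  by (auto simp: full_def)

lemma full_mono: "full P \<sigma> \<Longrightarrow> (\<And>i. Q i \<le> P i) \<Longrightarrow> full Q \<sigma>"
  unfolding full_def by (meson order_trans)

lemma part_mono: "part P \<sigma> \<Longrightarrow> (\<And>i. Q i \<le> P i) \<Longrightarrow> part Q \<sigma>"
  unfolding part_def by (meson order_trans)

lemma full_imp_part: "full P \<sigma> \<Longrightarrow> part P \<sigma>"
  by (simp add: full_def part_def)

lemma part_up: "part P \<sigma> \<Longrightarrow> part (case_nat l P) (up \<sigma>)"
  unfolding part_def
proof
  fix i assume P: "\<forall>i. (\<exists>x. \<sigma> i = Var x) \<or> (\<exists>p\<ge>P i. \<sigma> i = tup p)"
  show "(\<exists>x. up \<sigma> i = Var x) \<or> (\<exists>p\<ge>case_nat l P i. up \<sigma> i = tup p)"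
  proof (cases i)
    case (Suc j)
    with P[rule_format, of j] show ?thesis by auto
  qed simp
qed

lemma hplus_msubst_wh: "wh M N \<Longrightarrow> hplus (msubst \<sigma> M) (msubst \<sigma> N)"
  by (blast intro: hplus_betas wh_imp_beta wh_msubst)

text \<open>An abstraction on one side is met by an eta-expansion of the other: both are applied to
  \<tau> \<open>0\<close>. The equation for \<open>P\<close> holds without regard to this tuple, so
  any bound \<open>l\<close> may be imposed on it.\<close>

lemma hplus_msubst_Abs:
  assumes H: "\<And>\<sigma>. full P \<sigma> \<Longrightarrow> hplus (msubst \<sigma> A) (msubst \<sigma> (Abs B))"
    and "full (case_nat l P) \<tau>"
  shows "hplus (msubst \<tau> (App (ren Suc A) (Var 0))) (msubst \<tau> B)"
proof -
  define \<sigma> where "\<sigma> = (\<lambda>i. \<tau> (Suc i))"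
  have "full P \<sigma>"
    unfolding full_def
  proof
    fix i show "\<exists>p\<ge>P i. \<sigma> i = tup p"
      using assms(2)[unfolded full_def, rule_format, of "Suc i"] by (simp add: \<sigma>_def)
  qed
  then have "hplus (App (msubst \<sigma> A) (\<tau> 0)) (App (msubst \<sigma> (Abs B)) (\<tau> 0))"
    by (intro hplus_App H hplus_refl)
  moreover have "hplus (App (msubst \<sigma> (Abs B)) (\<tau> 0)) (subst (msubst (up \<sigma>) B) (\<tau> 0) 0)"
    by (auto intro: hplus_betas beta_red)
  moreover have "case_nat (\<tau> 0) \<sigma> = \<tau>"
    by (auto simp: \<sigma>_def split: nat.split)
  ultimately show ?thesis
    by (auto simp: subst_msubst_up msubst_ren \<sigma>_def intro: hplus_trans)
qed

text \<open>Spines with different heads or arities could be given different numbers of missing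
  arguments, against \<open>not_hplus_tup\<close>. To extract an argument the tuple at
  \<open>v\<close> must store all of them before its selector comes, hence the raised bound.\<close>

lemma boehm_out:
  assumes H: "\<And>\<sigma>. full P \<sigma> \<Longrightarrow> hplus (msubst \<sigma> (apps (Var v) As)) (msubst \<sigma> (apps (Var w) Bs))"
  shows "v = w" and "length As = length Bs"
    and "full (P(v := max (P v) (length As))) \<sigma> \<Longrightarrow> i < length As \<Longrightarrow>
      hplus (msubst \<sigma> (As ! i)) (msubst \<sigma> (Bs ! i))"
proof -
  show vw: "v = w"
  proof (rule ccontr)
    assume "v \<noteq> w"
    \<comment> \<open>Distinct variables admit separate widths; \<open>p\<close> is taken so large
      that \<open>a > b\<close>.\<close>
    define q where "q = max (P w) (length Bs)"
    define b where "b = q - length Bs"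
    define p where "p = max (P v) (length As + Suc b)"
    define a where "a = p - length As"
    define \<sigma> where "\<sigma> = (\<lambda>i. tup ((P(v := p, w := q)) i))"
    have "full P \<sigma>" unfolding \<sigma>_def by (rule full_tup) (simp add: p_def q_def)
    from H[OF this] have "hplus (apps (tup p) (map (msubst \<sigma>) As)) (apps (tup q) (map (msubst \<sigma>) Bs))"
      using \<open>v \<noteq> w\<close> by (simp add: msubst_apps \<sigma>_def)
    moreover have "length As + a = p" "length Bs + b = q" "a \<noteq> b"
      by (auto simp: a_def b_def p_def q_def)
    ultimately show False using not_hplus_tup by (metis length_map)
  qed
  show len: "length As = length Bs"
  proof (rule ccontr)
    assume ne: "length As \<noteq> length Bs"
    \<comment> \<open>A single width holding either spine leaves different numbers of missing
      arguments.\<close>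
    define p where "p = max (P v) (max (length As) (length Bs))"
    define \<sigma> where "\<sigma> = (\<lambda>i. tup ((P(v := p)) i))"
    have "full P \<sigma>" unfolding \<sigma>_def by (rule full_tup) (simp add: p_def)
    from H[OF this] have "hplus (apps (tup p) (map (msubst \<sigma>) As)) (apps (tup p) (map (msubst \<sigma>) Bs))"
      using vw by (simp add: msubst_apps \<sigma>_def)
    moreover have "length As + (p - length As) = p" "length Bs + (p - length Bs) = p"
      "p - length As \<noteq> p - length Bs" using ne by (auto simp: p_def)
    ultimately show False using not_hplus_tup by (metis length_map)
  qed
  assume full: "full (P(v := max (P v) (length As))) \<sigma>" and i: "i < length As"
  then obtain p where p: "\<sigma> v = tup p" "length As \<le> p"
    unfolding full_def by (metis fun_upd_same max.bounded_iff)
  \<comment> \<open>The slots behind the arguments get fillers that the selector discards. Position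
    \<open>i\<close> among \<open>p\<close> arguments has index \<open>p - Suc i\<close>.\<close>
  define Os where "Os = replicate (p - length As) Omega"
  define sel where "sel = absn p (Var (p - Suc i))"
  have red: "hplus (apps (apps (tup p) Xs) (Os @ [sel])) (Xs ! i)" if "length Xs = length As" for Xs
  proof -
    have "beta\<^sup>*\<^sup>* (apps (apps (tup p) Xs) (Os @ [sel])) (apps sel (Xs @ Os))"
      using betas_tup[of "Xs @ Os" p sel "[]"] that p(2) by (simp add: Os_def flip: apps_append)
    moreover have "length (Xs @ Os) = p" using that p(2) by (simp add: Os_def)
    from betas_apps_absn[OF this, of "Var (p - Suc i)"]
    have "beta\<^sup>*\<^sup>* (apps sel (Xs @ Os)) (Xs ! i)"
      using that p(2) i by (simp add: sel_def nth_append)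
    ultimately show ?thesis by (meson hplus_betas rtranclp_trans)
  qed
  have "full P \<sigma>" using full by (rule full_mono) simp
  from hplus_apps[OF H[OF this], of "Os @ [sel]"] vw p(1)
  have "hplus (apps (apps (tup p) (map (msubst \<sigma>) As)) (Os @ [sel]))
              (apps (apps (tup p) (map (msubst \<sigma>) Bs)) (Os @ [sel]))"
    by (simp add: msubst_apps)
  with red[of "map (msubst \<sigma>) As"] red[of "map (msubst \<sigma>) Bs"] len i
  show "hplus (msubst \<sigma> (As ! i)) (msubst \<sigma> (Bs ! i))"
    by (metis hplus_sym hplus_trans length_map nth_map)
qed

text \<open>The eta-expansion case.  The hypothesis is about closing substitutions only, while \<open>\<rho>\<close>
  supplies the induction: it leaves \<open>v\<close> free, so it stays admissible when the bound at \<open>v\<close> grows.\<close>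

lemma nm_if_hplus_free_neutral:
  assumes "nm (msubst \<rho> B)" "part P \<rho>" "\<exists>x. \<rho> v = Var x" "\<forall>y\<in>set ys. \<exists>x. \<rho> y = Var x"
    and "\<And>\<sigma>. full P \<sigma> \<Longrightarrow> hplus (msubst \<sigma> (apps (Var v) (map Var ys))) (msubst \<sigma> B)"
  shows "nm B"
  using assms
proof (induction arbitrary: P v ys rule: nm_msubst_induct)
  case (wh \<rho> B B')
  have "nm B'"
    using wh.prems(1-3)
  proof (rule wh.IH)
    fix \<sigma> assume "full P \<sigma>"
    from hplus_trans[OF wh.prems(4)[OF this] hplus_msubst_wh[OF wh.hyps]]
    show "hplus (msubst \<sigma> (apps (Var v) (map Var ys))) (msubst \<sigma> B')" .
  qed
  with wh.hyps show ?case by (rule nm_whI)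
next
  case (Abs \<rho> B)
  have "nm B"
  proof (rule Abs.IH)
    \<comment> \<open>The new variable stays free under \<open>up\<close> \<rho>, so it can join
      \<open>ys\<close>, and the bound 0 suffices for it.\<close>
    show "part (case_nat 0 P) (up \<rho>)" using Abs.prems(1) by (rule part_up)
    show "\<exists>x. up \<rho> (Suc v) = Var x" using Abs.prems(2) by auto
    show "\<forall>y\<in>set (map Suc ys @ [0]). \<exists>x. up \<rho> y = Var x" using Abs.prems(3) by fastforce
    fix \<tau> assume "full (case_nat 0 P) \<tau>"
    with Abs.prems(4) have "hplus (msubst \<tau> (App (ren Suc (apps (Var v) (map Var ys))) (Var 0))) (msubst \<tau> B)"
      by (rule hplus_msubst_Abs)
    moreover have "App (ren Suc (apps (Var v) (map Var ys))) (Var 0)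
        = apps (Var (Suc v)) (map Var (map Suc ys @ [0]))"
      by (simp add: ren_apps apps_snoc comp_def)
    ultimately show "hplus (msubst \<tau> (apps (Var (Suc v)) (map Var (map Suc ys @ [0])))) (msubst \<tau> B)"
      by simp
  qed
  then show ?case by simp
next
  case (neutral \<rho> w Bs)
  from boehm_out[OF neutral.prems(4)]
  have vw: "v = w" and len: "length ys = length Bs"
    and args: "\<And>\<sigma> i. full (P(v := max (P v) (length ys))) \<sigma> \<Longrightarrow> i < length ys \<Longrightarrow>
      hplus (msubst \<sigma> (map Var ys ! i)) (msubst \<sigma> (Bs ! i))"
    by simp_all
  have "nm (Bs ! i)" if "i < length Bs" for i
  proof -
    obtain x where x: "\<rho> w = Var x" using neutral.prems(2) vw by blast
    have "Bs ! i \<in> set Bs" using that by simp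
    from x this show ?thesis
    proof (rule neutral.IH)
      \<comment> \<open>The raised bound is at \<open>v\<close>, where \<rho> has a variable, so
        \<rho> remains admissible. The argument of \<open>B\<close> is then an expansion of
        \<open>ys ! i\<close> with an empty spine.\<close>
      show "part (P(v := max (P v) (length ys))) \<rho>"
        using neutral.prems(1,2) by (auto simp: part_def)
      show "\<exists>x. \<rho> (ys ! i) = Var x" using neutral.prems(3) that len by simp
      show "\<forall>y\<in>set []. \<exists>x. \<rho> y = Var x" by simp
      show "hplus (msubst \<sigma> (apps (Var (ys ! i)) (map Var []))) (msubst \<sigma> (Bs ! i))"
        if "full (P(v := max (P v) (length ys))) \<sigma>" for \<sigma>
        using args[OF that, of i] \<open>i < length Bs\<close> len by simp
    qed
  qed
  then show ?case by (auto simp: in_set_conv_nth)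
qed

text \<open>Quantifying over renamings makes \<open>good\<close> stable under passing below the abstractions of \<open>B\<close>.\<close>

definition good :: "lterm \<Rightarrow> bool" where
  "good A \<longleftrightarrow> (\<forall>r P B. (\<forall>\<sigma>. full P \<sigma> \<longrightarrow> hplus (msubst \<sigma> (ren r A)) (msubst \<sigma> B)) \<longrightarrow> nm B)"

lemma goodD:
  assumes "good A" and "\<And>\<sigma>. full P \<sigma> \<Longrightarrow> hplus (msubst \<sigma> A) (msubst \<sigma> B)"
  shows "nm B"
proof -
  have "ren (\<lambda>i. i) A = A" by (simp add: ren_conv_msubst)
  with assms show ?thesis unfolding good_def by metis
qed

lemma good_ren: "good A \<Longrightarrow> good (ren r A)"
  unfolding good_def ren_ren by blast

text \<open>\<open>As\<close> holds arguments of the original term, which are \<open>good\<close>,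
  and variables added by eta-expansion for the abstractions of \<open>B\<close>, which \<rho> leaves
  free. The former are settled by \<open>goodD\<close>, the latter by
  \<open>nm_if_hplus_free_neutral\<close> with the instance \<rho>.\<close>

lemma nm_if_hplus_good_neutral:
  assumes "hn l B" "\<And>i. l \<le> P i" "part P \<rho>" "nm (msubst \<rho> B)"
    and "\<forall>A\<in>set As. good A \<or> (\<exists>y x. A = Var y \<and> \<rho> y = Var x)"
    and "\<And>\<sigma>. full P \<sigma> \<Longrightarrow> hplus (msubst \<sigma> (apps (Var v) As)) (msubst \<sigma> B)"
  shows "nm B"
  using assms
proof (induction arbitrary: P \<rho> v As rule: hn.induct)
  case (hn_neutral Bs w)
  from boehm_out[OF hn_neutral.prems(5)]
  have vw: "v = w" and len: "length As = length Bs"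
    and args: "\<And>\<sigma> i. full (P(v := max (P v) (length As))) \<sigma> \<Longrightarrow> i < length As \<Longrightarrow>
      hplus (msubst \<sigma> (As ! i)) (msubst \<sigma> (Bs ! i))"
    by simp_all
  have "length As \<le> P v" using len hn_neutral.hyps hn_neutral.prems(1)[of v] by simp
  \<comment> \<open>The bound \<open>l\<close> pays off: \<open>P v\<close> already reaches the
    arity, so extraction raises nothing and \<rho> stays admissible.\<close>
  then have "P(v := max (P v) (length As)) = P" by auto
  with args have args: "\<And>\<sigma> i. full P \<sigma> \<Longrightarrow> i < length As \<Longrightarrow>
      hplus (msubst \<sigma> (As ! i)) (msubst \<sigma> (Bs ! i))" by simp
  have nms: "nm (msubst \<rho> B)" if "B \<in> set Bs" for B
  proof -
    have nm: "nm (apps (\<rho> w) (map (msubst \<rho>) Bs))"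
      using hn_neutral.prems(3) by (simp add: msubst_apps)
    from hn_neutral.prems(2) have "(\<exists>x. \<rho> w = Var x) \<or> (\<exists>p\<ge>P w. \<rho> w = tup p)"
      by (simp add: part_def)
    then show ?thesis
    proof (elim disjE exE conjE)
      fix x assume "\<rho> w = Var x"
      with nm that show ?thesis by simp
    next
      fix p assume p: "P w \<le> p" "\<rho> w = tup p"
      then have "length (map (msubst \<rho>) Bs) \<le> p"
        using hn_neutral.hyps hn_neutral.prems(1)[of w] by simp
      from nm_tup[OF this] nm p that show ?thesis by simp
    qed
  qed
  have "nm (Bs ! i)" if "i < length Bs" for i
  proof -
    from hn_neutral.prems(4) that len
    have "good (As ! i) \<or> (\<exists>y x. As ! i = Var y \<and> \<rho> y = Var x)" by simp
    then show ?thesis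
    proof (elim disjE exE conjE)
      assume "good (As ! i)"
      then show ?thesis by (rule goodD) (use args that len in simp)
    next
      fix y x assume y: "As ! i = Var y" "\<rho> y = Var x"
      show ?thesis
      proof (rule nm_if_hplus_free_neutral)
        show "nm (msubst \<rho> (Bs ! i))" using nms that by simp
        show "part P \<rho>" by (rule hn_neutral.prems)
        show "\<exists>x. \<rho> y = Var x" using y by blast
        show "\<forall>y\<in>set []. \<exists>x. \<rho> y = Var x" by simp
        show "hplus (msubst \<sigma> (apps (Var y) (map Var []))) (msubst \<sigma> (Bs ! i))" if "full P \<sigma>" for \<sigma>
          using args[OF that, of i] \<open>i < length Bs\<close> len y by simp
      qed
    qed
  qed
  then show ?case by (auto simp: in_set_conv_nth)
next
  case (hn_Abs B)
  have "nm B"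
  proof (rule hn_Abs.IH)
    show "l \<le> case_nat l P i" for i using hn_Abs.prems(1) by (simp split: nat.split)
    show "part (case_nat l P) (up \<rho>)" using hn_Abs.prems(2) by (rule part_up)
    show "nm (msubst (up \<rho>) B)" using hn_Abs.prems(3) by simp
    show "\<forall>A\<in>set (map (ren Suc) As @ [Var 0]). good A \<or> (\<exists>y x. A = Var y \<and> up \<rho> y = Var x)"
    proof
      fix A assume "A \<in> set (map (ren Suc) As @ [Var 0])"
      then consider A' where "A' \<in> set As" "A = ren Suc A'" | "A = Var 0" by auto
      then show "good A \<or> (\<exists>y x. A = Var y \<and> up \<rho> y = Var x)"
      proof cases
        case 1
        with hn_Abs.prems(4) have "good A' \<or> (\<exists>y x. A' = Var y \<and> \<rho> y = Var x)" by blast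
        then show ?thesis
        proof (elim disjE exE conjE)
          assume "good A'"
          with 1 show ?thesis by (simp add: good_ren)
        next
          fix y x assume "A' = Var y" "\<rho> y = Var x"
          with 1 have "A = Var (Suc y)" "up \<rho> (Suc y) = Var (Suc x)" by simp_all
          then show ?thesis by blast
        qed
      qed simp
    qed
    fix \<tau> assume "full (case_nat l P) \<tau>"
    with hn_Abs.prems(5) have "hplus (msubst \<tau> (App (ren Suc (apps (Var v) As)) (Var 0))) (msubst \<tau> B)"
      by (rule hplus_msubst_Abs)
    moreover have "App (ren Suc (apps (Var v) As)) (Var 0)
        = apps (Var (Suc v)) (map (ren Suc) As @ [Var 0])"
      by (simp add: ren_apps apps_snoc)
    ultimately show "hplus (msubst \<tau> (apps (Var (Suc v)) (map (ren Suc) As @ [Var 0]))) (msubst \<tau> B)"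
      by simp
  qed
  then show ?case by simp
next
  case (hn_wh B B')
  have "nm B'"
    using hn_wh.prems(1,2)
  proof (rule hn_wh.IH)
    show "nm (msubst \<rho> B')" using hn_wh.prems(3) nm_wh[OF wh_msubst[OF hn_wh.hyps(1)]] by simp
    show "\<forall>A\<in>set As. good A \<or> (\<exists>y x. A = Var y \<and> \<rho> y = Var x)" by (rule hn_wh.prems)
    fix \<sigma> assume "full P \<sigma>"
    from hplus_trans[OF hn_wh.prems(5)[OF this] hplus_msubst_wh[OF hn_wh.hyps(1)]]
    show "hplus (msubst \<sigma> (apps (Var v) As)) (msubst \<sigma> B')" .
  qed
  with hn_wh.hyps(1) show ?case by (rule nm_whI)
qed

text \<open>A finite Boehm tree has a largest arity. Tuples at least that wide are never given their
  selector, so they block no less than the variables they replace.\<close>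

lemma nm_msubst_large_tup: "nm A \<Longrightarrow> \<exists>p. \<forall>\<sigma>. part (\<lambda>_. p) \<sigma> \<longrightarrow> nm (msubst \<sigma> A)"
proof (induction rule: nm.induct)
  case (nm_neutralI Ms y)
  then obtain f where f: "\<And>M \<sigma>. M \<in> set Ms \<Longrightarrow> part (\<lambda>_. f M) \<sigma> \<Longrightarrow> nm (msubst \<sigma> M)" by metis
  define p where "p = Max (insert (length Ms) (f ` set Ms))"
  have len: "length Ms \<le> p" and fp: "\<And>M. M \<in> set Ms \<Longrightarrow> f M \<le> p" by (simp_all add: p_def)
  have "nm (msubst \<sigma> (apps (Var y) Ms))" if part: "part (\<lambda>_. p) \<sigma>" for \<sigma>
  proof -
    have Ms: "\<forall>X\<in>set (map (msubst \<sigma>) Ms). nm X"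
      using f fp part_mono[OF part] by auto
    from part have "(\<exists>x. \<sigma> y = Var x) \<or> (\<exists>q\<ge>p. \<sigma> y = tup q)" by (simp add: part_def)
    then show ?thesis
    proof (elim disjE exE conjE)
      fix x assume "\<sigma> y = Var x"
      with Ms show ?thesis by (simp add: msubst_apps)
    next
      fix q assume "p \<le> q" "\<sigma> y = tup q"
      with Ms len nm_tup[of "map (msubst \<sigma>) Ms" q] show ?thesis by (simp add: msubst_apps)
    qed
  qed
  then show ?case by blast
next
  case (nm_AbsI M)
  then obtain p where p: "\<And>\<sigma>. part (\<lambda>_. p) \<sigma> \<Longrightarrow> nm (msubst \<sigma> M)" by blast
  have "case_nat p (\<lambda>_. p) = (\<lambda>_. p)" by (auto split: nat.split)
  then have "nm (msubst \<sigma> (Abs M))" if "part (\<lambda>_. p) \<sigma>" for \<sigma>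
    using p[of "up \<sigma>"] part_up[OF that, of p] by simp
  then show ?case by blast
next
  case (nm_whI M N)
  then show ?case by (meson nm.nm_whI wh_msubst)
qed

text \<open>The neutral case carries the content: a normalising instance of \<open>B\<close> is
  found and handed to \<open>nm_if_hplus_good_neutral\<close>. An abstraction in \<open>A\<close> is
  removed by eta-expanding \<open>B\<close>.\<close>

lemma nm_imp_good: "nm A \<Longrightarrow> good A"
proof (induction rule: nm.induct)
  case (nm_neutralI As v)
  show ?case
    unfolding good_def
  proof (intro allI impI)
    fix r P B assume H: "\<forall>\<sigma>. full P \<sigma> \<longrightarrow> hplus (msubst \<sigma> (ren r (apps (Var v) As))) (msubst \<sigma> B)"
    let ?A = "ren r (apps (Var v) As)"
    have "nm ?A" using nm_neutralI.hyps by (intro nm_ren) simp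
    then obtain p where p: "\<And>\<sigma>. part (\<lambda>_. p) \<sigma> \<Longrightarrow> nm (msubst \<sigma> ?A)"
      using nm_msubst_large_tup by blast
    \<comment> \<open>\<open>l\<close> remains a parameter: the instance for 0 yields a head normal
      form of \<open>B\<close>, whose arity then determines the final widths.\<close>
    have nmB: "nm (msubst (\<lambda>i. tup (max (P i) (max p l))) B)" (is "nm (msubst ?\<sigma> B)") for l
    proof -
      have "full P ?\<sigma>" "full (\<lambda>_. p) ?\<sigma>" by (auto intro: full_tup)
      with H p show ?thesis by (blast dest: hplus_nmD intro: full_imp_part)
    qed
    from nmB[of 0] obtain l where l: "hn l B"
      using nm_apps_msubst_imp_hn[where Ps = "[]"] by fastforce
    let ?P = "\<lambda>i. max (P i) (max p l)"
    from l show "nm B"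
    proof (rule nm_if_hplus_good_neutral)
      show "l \<le> ?P i" for i by simp
      show "part ?P (\<lambda>i. tup (?P i))" by (auto intro: full_imp_part full_tup)
      show "nm (msubst (\<lambda>i. tup (?P i)) B)" by (rule nmB)
      show "\<forall>A\<in>set (map (ren r) As). good A \<or> (\<exists>y x. A = Var y \<and> tup (?P y) = Var x)"
        using nm_neutralI.IH by (simp add: good_ren)
      fix \<sigma> assume "full ?P \<sigma>"
      then have "full P \<sigma>" by (rule full_mono) simp
      with H show "hplus (msubst \<sigma> (apps (Var (r v)) (map (ren r) As))) (msubst \<sigma> B)"
        by (simp add: ren_apps)
    qed
  qed
next
  case (nm_AbsI A)
  show ?case
    unfolding good_def
  proof (intro allI impI)
    fix r P B assume H: "\<forall>\<sigma>. full P \<sigma> \<longrightarrow> hplus (msubst \<sigma> (ren r (Abs A))) (msubst \<sigma> B)"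
    let ?r = "case_nat 0 (\<lambda>i. Suc (r i))"
    \<comment> \<open>The roles are exchanged: here \<open>B\<close> is expanded and compared with
      the body of the abstraction.\<close>
    have "nm (App (ren Suc B) (Var 0))"
    proof (rule goodD)
      show "good (ren ?r A)" using nm_AbsI.IH by (rule good_ren)
      fix \<tau> assume full: "full (case_nat 0 P) \<tau>"
      have "hplus (msubst \<tau> (App (ren Suc B) (Var 0))) (msubst \<tau> (ren ?r A))"
        by (rule hplus_msubst_Abs[OF _ full]) (use H in \<open>auto intro: hplus_sym\<close>)
      then show "hplus (msubst \<tau> (ren ?r A)) (msubst \<tau> (App (ren Suc B) (Var 0)))"
        by (rule hplus_sym)
    qed
    then have "nm (ren Suc B)" by (simp add: nm_App_Var)
    \<comment> \<open>Contracting this auxiliary redex cancels the shift.\<close>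
    then have "nm (App (Abs (ren Suc B)) (Var 0))" by (simp add: nm_App_Var)
    moreover have "subst (ren Suc B) (Var 0) 0 = B"
      by (simp add: subst_conv_msubst msubst_ren)
    ultimately show "nm B" using nm_wh[OF wh_beta[of "ren Suc B" "Var 0"]] by simp
  qed
next
  case (nm_whI A A')
  show ?case
    unfolding good_def
  proof (intro allI impI)
    fix r P B assume H: "\<forall>\<sigma>. full P \<sigma> \<longrightarrow> hplus (msubst \<sigma> (ren r A)) (msubst \<sigma> B)"
    from good_ren[OF nm_whI.IH] show "nm B"
    proof (rule goodD)
      fix \<sigma> assume "full P \<sigma>"
      with H have "hplus (msubst \<sigma> (ren r A)) (msubst \<sigma> B)" by blast
      with hplus_sym[OF hplus_msubst_wh[OF wh_ren[OF nm_whI.hyps(1)]]]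
      show "hplus (msubst \<sigma> (ren r A')) (msubst \<sigma> B)" by (rule hplus_trans)
    qed
  qed
qed

section \<open>The omega rule\<close>

lemma closed_at_ren: "closed_at k M \<Longrightarrow> (\<And>i. i < k \<Longrightarrow> r i < n) \<Longrightarrow> closed_at n (ren r M)"
proof (induction M arbitrary: k r n)
  case (App M N)
  from App.IH[of k r n] App.prems show ?case by simp
next
  case (Abs M)
  have "closed_at (Suc n) (ren (case_nat 0 (\<lambda>i. Suc (r i))) M)"
    by (rule Abs.IH[of "Suc k"]) (use Abs.prems in \<open>auto split: nat.split\<close>)
  then show ?case by simp
qed simp

lemma closed_at_msubst: "(\<And>i. closed_at k (\<sigma> i)) \<Longrightarrow> closed_at k (msubst \<sigma> M)"
proof (induction M arbitrary: k \<sigma>)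
  case (Abs M)
  have "closed_at (Suc k) (up \<sigma> i)" for i
    using Abs.prems by (cases i) (auto intro: closed_at_ren)
  then have "closed_at (Suc k) (msubst (up \<sigma>) M)" by (rule Abs.IH)
  then show ?case by simp
qed simp_all

lemma closed_msubst_full: "full P \<sigma> \<Longrightarrow> closed (msubst \<sigma> M)"
  unfolding closed_def by (rule closed_at_msubst) (metis closed_def closed_tup full_def)

text \<open>Applying both sides to the variables \<open>n - 1\<close> down to 0 restores the free
  indices bound by the abstractions.\<close>

lemma hplus_absn_imp_hplus:
  assumes "closed_at n M" "closed_at n N" and "hplus (absn n M) (absn n N)"
  shows "hplus M N"
proof -
  let ?ts = "map (\<lambda>i. Var (n - Suc i)) [0..<n]"
  have red: "hplus (apps (absn n X) ?ts) X" if "closed_at n X" for X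
  proof -
    have "msubst (\<lambda>i. if i < n then ?ts ! (n - Suc i) else Var (i - n)) X = msubst Var X"
      using that by (rule msubst_cong_closed_at) simp
    with betas_apps_absn[of ?ts n X] show ?thesis by (simp add: hplus_betas)
  qed
  show ?thesis
    using hplus_apps[OF assms(3), of ?ts] red assms(1,2) by (blast intro: hplus_sym hplus_trans)
qed

text \<open>The first \<open>n\<close> arguments stand for the free variables, and the next is a
  closed \<open>P\<close> for the omega hypothesis. Congruence under \<open>absn\<close> carries
  that equation between open terms over.\<close>

lemma hplus_apps_absn_closed:
  assumes H: "\<And>P. closed P \<Longrightarrow> hplus (App M P) (App N P)"
    and closed: "\<forall>P\<in>set Ps. closed P" and len: "n < length Ps"
  shows "hplus (apps (absn n M) Ps) (apps (absn n N) Ps)"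
proof -
  define Qs P Rs where "Qs = take n Ps" and "P = Ps ! n" and "Rs = drop (Suc n) Ps"
  have Ps: "Ps = Qs @ P # Rs" and Qs: "length Qs = n" and P: "closed P"
    using len closed by (auto simp: Qs_def P_def Rs_def intro: id_take_nth_drop)
  let ?s = "\<lambda>i. if i < n then Qs ! (n - Suc i) else Var (i - n)"
  have red: "hplus (apps (absn n (App X P)) Qs) (apps (absn n X) (Qs @ [P]))" for X
  proof -
    have "beta\<^sup>*\<^sup>* (apps (absn n (App X P)) Qs) (App (msubst ?s X) P)"
      using betas_apps_absn[OF Qs, of "App X P"] P by (simp add: msubst_closed)
    moreover have "beta\<^sup>*\<^sup>* (apps (absn n X) (Qs @ [P])) (App (msubst ?s X) P)"
      using betas_apps_absn[OF Qs, of X] by (simp add: apps_snoc betas_App)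
    ultimately show ?thesis by (blast intro: hplus_betas hplus_sym hplus_trans)
  qed
  have "hplus (apps (absn n (App M P)) Qs) (apps (absn n (App N P)) Qs)"
    by (intro hplus_apps hplus_absn H P)
  with red have "hplus (apps (absn n M) (Qs @ [P])) (apps (absn n N) (Qs @ [P]))"
    by (blast intro: hplus_sym hplus_trans)
  from hplus_apps[OF this, of Rs] show ?thesis by (simp add: Ps flip: apps_append)
qed

theorem hplus_omega:
  assumes H: "\<And>P. closed P \<Longrightarrow> hplus (App M P) (App N P)"
  shows "hplus M N"
proof -
  obtain k l where "closed_at k M" "closed_at l N" using ex_closed_at by metis
  then obtain n where n: "closed_at n M" "closed_at n N"
    using closed_at_mono[of k M "max k l"] closed_at_mono[of l N "max k l"] by simp
  then have closed: "closed (absn n M)" "closed (absn n N)"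
    by (simp_all add: closed_def closed_at_absn)
  have imp: "nm (apps (absn n N) Ps)"
    if H: "\<And>P. closed P \<Longrightarrow> hplus (App M P) (App N P)"
      and closed: "closed (absn n M)" "closed (absn n N)" and nm: "nm (apps (absn n M) Ps)"
    for M N Ps
  proof -
    \<comment> \<open>At least \<open>n + 1\<close> arguments are required, \<open>n\<close> for the
      free variables and one for the omega hypothesis; appended variables do not affect
      \<open>nm\<close>.\<close>
    let ?Ps = "Ps @ replicate (Suc n) (Var 0)"
    have "nm (apps (absn n M) ?Ps)" using nm by (simp only: apps_append nm_apps_Vars)
    then have "good (apps (absn n M) ?Ps)" by (rule nm_imp_good)
    then have "nm (apps (absn n N) ?Ps)"
    proof (rule goodD)
      \<comment> \<open>Tuples of any width close all arguments, so the bound can start at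
        0.\<close>
      fix \<sigma> assume full: "full (\<lambda>_. 0) \<sigma>"
      have "hplus (apps (absn n M) (map (msubst \<sigma>) ?Ps)) (apps (absn n N) (map (msubst \<sigma>) ?Ps))"
        using H by (rule hplus_apps_absn_closed)
          (use closed_msubst_full[OF full] closed_msubst_full[OF full, of "Var 0"]
           in \<open>auto simp del: replicate_Suc\<close>)
      with closed show "hplus (msubst \<sigma> (apps (absn n M) ?Ps)) (msubst \<sigma> (apps (absn n N) ?Ps))"
        by (simp add: msubst_apps msubst_closed del: replicate_Suc)
    qed
    then show ?thesis by (simp only: apps_append nm_apps_Vars)
  qed
  have "hplus (absn n M) (absn n N)"
    using closed by (rule context_lemma) (use imp H hplus_sym closed in blast)
  with n show ?thesis by (rule hplus_absn_imp_hplus)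
qed

theorem mainTheorem2:
  shows "(\<forall>M N. (\<forall>P. closed P \<longrightarrow> hplus (App M P) (App N P)) \<longrightarrow> hplus M N)
         \<and> (\<forall>M N. bomega M N \<longrightarrow> hplus M N)"
proof (intro conjI allI impI)
  fix M N assume "\<forall>P. closed P \<longrightarrow> hplus (App M P) (App N P)"
  then show "hplus M N" by (blast intro: hplus_omega)
next
  fix M N assume "bomega M N"
  then show "hplus M N"
  proof induction
    case (bo_omega M N)
    then show ?case by (blast intro: hplus_omega)
  qed (auto intro: bt_eq_imp_hplus hplus_beta_conv hplus_refl hplus_sym hplus_trans
         hplus_App hplus_Abs)
qed

end
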